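(* Let $\varphi$ and $\psi$ be any admissible functions. If $a=S_\varphi f$ for some $f\in\mathcal S'/\mathcal P$, then $a\in D(T_\psi)$, and $$\langle T_\psi(S_\varphi f),\phi\rangle=\sum_{\nu=-\infty}^{\infty}\sum_{k\in\mathbb{Z}^n}(S_\varphi f)_{Q_{\nu k}}\langle\psi_{Q_{\nu k}},\phi\rangle\qquad\text{for all }\phi\in\mathcal Z,$$ where the terms are integrable on $\mathcal Q$ with respect to counting measure (i.e. absolutely summable over $Q\in\mathcal Q$). In short, the range of $S_\varphi$ is contained in the domain of $T_\psi$.
   Context: Fourier transform: $\hat f(\xi)=\int e^{-i x\cdot\xi}f(x)\,dx$ on $\mathbb{R}^n$. Pairings are anti-linear in the second slot: $\langle f,\phi\rangle=\int f\overline{\phi}\,dx$ for functions. $\mathcal S$, $\mathcal S'$ are the Schwartz functions and tempered distributions on $\mathbb{R}^n$. Admissibility: fix constants $0<K_0<K_1<1<K^1<K^0$ with $2K_1<K^1$ and $K^0<\pi$. A function $\varphi\in\mathcal S$ is admissible (always for these same constants) if $\operatorname{supp}\hat\varphi\subset\{\xi: K_0\le|\xi|\le K^0\}$ and, for some $c>0$, $|\hat\varphi(\xi)|\ge c$ for $K_1\le|\xi|\le K^1$. Dyadic cubes: for $\nu\in\mathbb{Z}$, $k\in\mathbb{Z}^n$, $Q_{\nu k}=\{x\in\mathbb{R}^n: k_i\le 2^\nu x_i<k_i+1,\ i=1,\dots,n\}$; $\mathcal Q$ is the set of all of these. For $Q=Q_{\nu k}$ set $\varphi_Q(x)=2^{n\nu/2}\varphi(2^\nu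 x-k)$, similarly $\psi_Q$. $\mathcal P$ is the space of polynomials; $\mathcal Z=\{\phi\in\mathcal S:\int x^\alpha\phi(x)\,dx=0\ \text{for all multiindices }\alpha\}$ with topology from $\mathcal S$; $\mathcal Z'=\mathcal S'/\mathcal P$ is its dual with the w$^*$-topology. Admissible functions belong to $\mathcal Z$ and are identified with their classes in $\mathcal Z'$. A "sequence" is a family $a=\{a_Q\}_{Q\in\mathcal Q}$ of complex numbers. For $f\in\mathcal S'/\mathcal P$, $S_\varphi f$ is the sequence with $(S_\varphi f)_Q=\langle f,\varphi_Q\rangle$. For admissible $\psi$, $D(T_\psi)$ is the set of sequences $a$ with $\sum_{Q\in\mathcal Q}|a_Q||\langle\psi_Q,\phi\rangle|<\infty$ for every $\phi\in\mathcal Z$; for $a\in D(T_\psi)$, $T_\psi a$ is the (well-defined) element of $\mathcal Z'$ with $\langle T_\psi a,\phi\rangle=\sum_{Q\in\mathcal Q}a_Q\langle\psi_Q,\phi\rangle$ for all $\phi\in\mathcal Z$. *)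

theory Defs
  imports "HOL-Analysis.Analysis"
begin

text \<open>Schwartz functions on \<open>\<real>\<^sup>n\<close>, with \<open>n = CARD('n)\<close>\<close>

definition partial_deriv :: "'n::finite \<Rightarrow> (real^'n \<Rightarrow> complex) \<Rightarrow> real^'n \<Rightarrow> complex"
  where "partial_deriv i f x = vector_derivative (\<lambda>t. f (x + t *\<^sub>R axis i 1)) (at 0)"

text \<open>Derivatives of higher order are indexed by the list of the directions of differentiation.
  On smooth functions the order of the list does not matter, so the lists give exactly the
  derivatives \<open>\<partial>\<^sup>\<beta>\<close>, \<open>\<beta>\<close> a multi-index.\<close>

definition partial_derivs :: "'n::finite list \<Rightarrow> (real^'n \<Rightarrow> complex) \<Rightarrow> real^'n \<Rightarrow> complex"
  where "partial_derivs is f = foldr partial_deriv is f"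

text \<open>Differentiability of every iterated partial derivative forces all of them to be continuous,
  so this is the usual \<open>C\<^sup>\<infinity>\<close>.\<close>

definition smooth :: "(real^'n::finite \<Rightarrow> complex) \<Rightarrow> bool"
  where "smooth f \<longleftrightarrow> (\<forall>is x. partial_derivs is f differentiable at x)"

definition monomial :: "('n::finite \<Rightarrow> nat) \<Rightarrow> real^'n \<Rightarrow> real"
  where "monomial \<alpha> x = (\<Prod>i\<in>UNIV. (x $ i) ^ \<alpha> i)"

definition schwartz :: "(real^'n::finite \<Rightarrow> complex) set"
  where "schwartz = {f. smooth f \<and>
           (\<forall>\<alpha> is. bounded (range (\<lambda>x. monomial \<alpha> x *\<^sub>R partial_derivs is f x)))}"

definition schwartz_seminorm ::
    "('n::finite \<Rightarrow> nat) \<Rightarrow> 'n list \<Rightarrow> (real^'n \<Rightarrow> complex) \<Rightarrow> real"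
  where "schwartz_seminorm \<alpha> is f = (SUP x. norm (monomial \<alpha> x *\<^sub>R partial_derivs is f x))"

text \<open>The locally convex topology of the seminorms; its underlying set is \<^const>\<open>schwartz\<close>.\<close>

definition schwartz_topology :: "(real^'n::finite \<Rightarrow> complex) topology"
  where "schwartz_topology = topology_generated_by
           {{g \<in> schwartz. schwartz_seminorm \<alpha> is (\<lambda>x. g x - f x) < e} | \<alpha> is f e.
              f \<in> schwartz \<and> 0 < e}"

definition fourier :: "(real^'n::finite \<Rightarrow> complex) \<Rightarrow> real^'n \<Rightarrow> complex"
  where "fourier f \<xi> = (LINT x|lborel. exp (- \<i> * complex_of_real (x \<bullet> \<xi>)) * f x)"

definition fun_pairing :: "(real^'n::finite \<Rightarrow> complex) \<Rightarrow> (real^'n \<Rightarrow> complex) \<Rightarrow> complex"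
  where "fun_pairing f h = (LINT x|lborel. f x * cnj (h x))"

text \<open>The space \<open>\<Z>\<close> of Schwartz functions all of whose moments vanish\<close>

definition Z_space :: "(real^'n::finite \<Rightarrow> complex) set"
  where "Z_space = {h \<in> schwartz. \<forall>\<alpha>. (LINT x|lborel. monomial \<alpha> x *\<^sub>R h x) = 0}"

text \<open>Since pairings are anti-linear in the second slot, distributions are anti-linear functionals.
  Functionals are taken extensional, so that they are determined by their values on the space.\<close>

definition antilinear_on ::
    "(real^'n::finite \<Rightarrow> complex) set \<Rightarrow> ((real^'n \<Rightarrow> complex) \<Rightarrow> complex) \<Rightarrow> bool"
  where "antilinear_on V u \<longleftrightarrow>
           (\<forall>f\<in>V. \<forall>g\<in>V. u (\<lambda>x. f x + g x) = u f + u g) \<and>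
           (\<forall>c. \<forall>f\<in>V. u (\<lambda>x. c * f x) = cnj c * u f)"

definition tempered_distributions :: "((real^'n::finite \<Rightarrow> complex) \<Rightarrow> complex) set"
  where "tempered_distributions = {u \<in> extensional schwartz.
           antilinear_on schwartz u \<and> continuous_map schwartz_topology euclidean u}"

definition Z_dual :: "((real^'n::finite \<Rightarrow> complex) \<Rightarrow> complex) set"
  where "Z_dual = {u \<in> extensional Z_space.
           antilinear_on Z_space u \<and>
           continuous_map (subtopology schwartz_topology Z_space) euclidean u}"

definition polynomials :: "(real^'n::finite \<Rightarrow> complex) set"
  where "polynomials = {p. \<exists>A c. finite A \<and> p = (\<lambda>x. \<Sum>\<alpha>\<in>A. c \<alpha> * complex_of_real (monomial \<alpha> x))}"

definition mod_polynomials ::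
    "(((real^'n::finite \<Rightarrow> complex) \<Rightarrow> complex) \<times> ((real^'n \<Rightarrow> complex) \<Rightarrow> complex)) set"
  where "mod_polynomials = {(u, v). u \<in> tempered_distributions \<and> v \<in> tempered_distributions \<and>
           (\<exists>p\<in>polynomials. \<forall>h\<in>schwartz. u h - v h = fun_pairing p h)}"

text \<open>The quotient \<open>\<S>'/\<P>\<close>. Its elements are cosets; they are paired with \<open>h \<in> \<Z>\<close> through
  the common value of all representatives.\<close>

definition tempered_mod_polynomials :: "((real^'n::finite \<Rightarrow> complex) \<Rightarrow> complex) set set"
  where "tempered_mod_polynomials = tempered_distributions // mod_polynomials"

definition class_pairing ::
    "((real^'n::finite \<Rightarrow> complex) \<Rightarrow> complex) set \<Rightarrow> (real^'n \<Rightarrow> complex) \<Rightarrow> complex"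
  where "class_pairing F h = (THE c. \<forall>u\<in>F. u h = c)"

text \<open>The constants \<open>K\<^sub>0 < K\<^sub>1 < 1 < K\<^sup>1 < K\<^sup>0\<close> are passed in this order.\<close>

definition admissible_constants :: "real \<Rightarrow> real \<Rightarrow> real \<Rightarrow> real \<Rightarrow> bool"
  where "admissible_constants Kl0 Kl1 Ku1 Ku0 \<longleftrightarrow>
           0 < Kl0 \<and> Kl0 < Kl1 \<and> Kl1 < 1 \<and> 1 < Ku1 \<and> Ku1 < Ku0 \<and> 2 * Kl1 < Ku1 \<and> Ku0 < pi"

definition admissible ::
    "real \<Rightarrow> real \<Rightarrow> real \<Rightarrow> real \<Rightarrow> (real^'n::finite \<Rightarrow> complex) \<Rightarrow> bool"
  where "admissible Kl0 Kl1 Ku1 Ku0 f \<longleftrightarrow>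
           f \<in> schwartz \<and>
           closure {\<xi>. fourier f \<xi> \<noteq> 0} \<subseteq> {\<xi>. Kl0 \<le> norm \<xi> \<and> norm \<xi> \<le> Ku0} \<and>
           (\<exists>c>0. \<forall>\<xi>. Kl1 \<le> norm \<xi> \<and> norm \<xi> \<le> Ku1 \<longrightarrow> c \<le> norm (fourier f \<xi>))"

definition dyadic_cube :: "int \<Rightarrow> int^'n::finite \<Rightarrow> (real^'n) set"
  where "dyadic_cube \<nu> k =
           {x. \<forall>i. of_int (k $ i) \<le> 2 powi \<nu> * x $ i \<and> 2 powi \<nu> * x $ i < of_int (k $ i) + 1}"

definition dyadic_cubes :: "(real^'n::finite) set set"
  where "dyadic_cubes = {dyadic_cube \<nu> k | \<nu> k. True}"

definition dilate :: "(real^'n::finite \<Rightarrow> complex) \<Rightarrow> int \<Rightarrow> int^'n \<Rightarrow> real^'n \<Rightarrow> complex"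
  where "dilate f \<nu> k x =
           complex_of_real (2 powr (real CARD('n) * of_int \<nu> / 2)) *
             f (2 powi \<nu> *\<^sub>R x - (\<chi> i. of_int (k $ i)))"

text \<open>The function \<open>f\<^sub>Q\<close>; a cube determines its \<open>\<nu>\<close> and \<open>k\<close> by \<open>inj_dyadic_cube\<close> below.\<close>

definition on_cube :: "(real^'n::finite \<Rightarrow> complex) \<Rightarrow> (real^'n) set \<Rightarrow> real^'n \<Rightarrow> complex"
  where "on_cube f Q = (case the_inv (\<lambda>(\<nu>, k). dyadic_cube \<nu> k) Q of (\<nu>, k) \<Rightarrow> dilate f \<nu> k)"

text \<open>Sequences are functions on \<^const>\<open>dyadic_cubes\<close>, extended by \<^const>\<open>undefined\<close>.\<close>

definition S_op ::
    "(real^'n::finite \<Rightarrow> complex) \<Rightarrow> ((real^'n \<Rightarrow> complex) \<Rightarrow> complex) set \<Rightarrow> (real^'n) set \<Rightarrow> complex"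
  where "S_op \<phi> F = (\<lambda>Q\<in>dyadic_cubes. class_pairing F (on_cube \<phi> Q))"

definition T_domain :: "(real^'n::finite \<Rightarrow> complex) \<Rightarrow> ((real^'n) set \<Rightarrow> complex) set"
  where "T_domain \<psi> = {a \<in> extensional dyadic_cubes. \<forall>h\<in>Z_space.
           (\<lambda>Q. norm (a Q) * norm (fun_pairing (on_cube \<psi> Q) h)) summable_on dyadic_cubes}"

definition T_op ::
    "(real^'n::finite \<Rightarrow> complex) \<Rightarrow> ((real^'n) set \<Rightarrow> complex) \<Rightarrow> (real^'n \<Rightarrow> complex) \<Rightarrow> complex"
  where "T_op \<psi> a = (THE u. u \<in> Z_dual \<and>
           (\<forall>h\<in>Z_space. u h = (\<Sum>\<^sub>\<infinity>Q\<in>dyadic_cubes. a Q * fun_pairing (on_cube \<psi> Q) h)))"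

lemma dyadic_cube_corner:
  "(\<chi> i. 2 powi (-\<nu>) * (of_int (k $ i) + t)) \<in> dyadic_cube \<nu> (k :: int^'n::finite)" if "0 \<le> t" "t < 1"
  using that by (simp add: dyadic_cube_def power_int_minus mult.assoc[symmetric])

lemma inj_dyadic_cube: "inj (\<lambda>(\<nu>, k :: int^'n::finite). dyadic_cube \<nu> k)"
proof (rule injI, clarify)
  have scale: "\<not> \<mu> < \<nu>" if eq: "dyadic_cube \<nu> k = dyadic_cube \<mu> l" for \<nu> \<mu> :: int and k l :: "int^'n"
  proof
    fix i :: 'n
    assume less: "\<mu> < \<nu>"
    define d where "d = 2 powi (\<nu> - \<mu>) - (1::real)"
    have "(2::real) powi 1 \<le> 2 powi (\<nu> - \<mu>)" using less by (intro power_int_increasing) auto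
    then have d: "1 \<le> d" by (simp add: d_def)
    have "2 powi \<nu> * (2 powi (-\<mu>) * (of_int (l $ i) + t)) \<in> {of_int (k $ i)..<of_int (k $ i) + 1}"
      if "0 \<le> t" "t < 1" for t :: real
      using dyadic_cube_corner[OF that, of \<mu> l] unfolding eq[symmetric]
      by (simp add: dyadic_cube_def)
    moreover have "(2::real) powi \<nu> * (2 powi (-\<mu>) * s) = (d + 1) * s" for s
      by (simp add: d_def power_int_diff power_int_minus field_simps)
    ultimately have "(d + 1) * (of_int (l $ i) + t) \<in> {of_int (k $ i)..<of_int (k $ i) + 1}"
      if "0 \<le> t" "t < 1" for t :: real
      using that by metis
    from this[of 0] this[of "1/2"] have "(d + 1) / 2 < 1" by (auto simp: algebra_simps add_divide_distrib)
    then show False using d by simp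
  qed
  fix \<nu> \<mu> :: int and k l :: "int^'n"
  assume eq: "dyadic_cube \<nu> k = dyadic_cube \<mu> l"
  then have \<nu>: "\<nu> = \<mu>" using scale[of \<nu> k \<mu> l] scale[of \<mu> l \<nu> k] by force
  have "k $ i = l $ i" for i
  proof -
    have "(\<chi> i. 2 powi (-\<nu>) * (of_int (k $ i) + 0)) \<in> dyadic_cube \<mu> l"
      using dyadic_cube_corner[of 0 \<nu> k] eq by simp
    then have "real_of_int (l $ i) \<le> of_int (k $ i)" "real_of_int (k $ i) < of_int (l $ i) + 1"
      by (auto simp: dyadic_cube_def \<nu> power_int_minus mult.assoc[symmetric])
    then show ?thesis by linarith
  qed
  then show "\<nu> = \<mu> \<and> k = l" using \<nu> by (simp add: vec_eq_iff)
qed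

lemma on_cube_dyadic_cube: "on_cube f (dyadic_cube \<nu> k) = dilate f \<nu> k"
  using the_inv_f_f[OF inj_dyadic_cube, of "(\<nu>, k)"] by (simp add: on_cube_def)

end

theory Submission
  imports Defs "HOL-Probability.Sinc_Integral"
begin

text \<open>A representative \<open>u\<close> of \<open>F\<close> is bounded by finitely many Schwartz seminorms, so
  \<open>(S\<^sub>\<phi> F)\<^sub>Q = u \<phi>\<^sub>Q\<close> grows at most like \<open>2\<^sup>M\<^sup>|\<^sup>\<nu>\<^sup>| (1 + |k|)\<^sup>M\<close> for some \<open>M\<close>. On the other
  side, \<open>\<langle>\<psi>\<^sub>Q, h\<rangle>\<close> decays faster than every power of \<open>2\<^sup>-\<^sup>|\<^sup>\<nu>\<^sup>| (1 + |k|)\<^sup>-\<^sup>1\<close>: after rescaling, it is an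
  integral of \<open>g(x) cnj (f(t x + v))\<close> with \<open>t = 2\<^sup>-\<^sup>|\<^sup>\<nu>\<^sup>|\<close>, where the moments of \<open>g\<close> vanish; \<open>g = \<psi>\<close> for
  \<open>\<nu> \<ge> 0\<close> and \<open>g = h\<close> for \<open>\<nu> < 0\<close>. The constants are Schwartz seminorms of \<open>h\<close>, which gives both the
  absolute convergence and the continuity of the sum in \<open>h\<close>.\<close>

section \<open>Calculus of Schwartz functions\<close>

text \<open>The moments of an admissible function vanish because its Fourier transform is zero near
  the origin. Every dilate inherits this, so the functions attached to cubes lie in \<Z> and can be
  paired with classes modulo polynomials. The order of choices matters: the growth exponent
  \<open>M\<close> depends on the distribution, and the decay order is then taken to be
  \<open>M + 2 * CARD('n)\<close>, which is possible because every order of decay is available. The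
  surplus \<open>2 * CARD('n)\<close> pays for the sum over the lattice points \<open>k\<close>. For
  \<open>\<nu> \<ge> 0\<close> the rescaled translation is \<open>v = t k\<close> and not
  \<open>k\<close>, so passing from \<open>(1 + |t k|)^N\<close> to \<open>(1 + |k|)^N\<close> costs
  \<open>t^N\<close>; this is why twice as many moments are spent as powers are wanted. Both
  \<open>T_op\<close> and \<open>class_pairing\<close> are definite descriptions, so the sum must be
  shown to lie in \<open>Z_dual\<close>, continuity included, before \<open>T_op\<close> can be
  evaluated; hence all bounds are kept linear in one norm of \<open>h\<close>.\<close>

lemma partial_derivs_simps:
  "partial_derivs [] f = f"
  "partial_derivs (i # is) f = partial_deriv i (partial_derivs is f)"
  "partial_derivs (is @ js) f = partial_derivs is (partial_derivs js f)"
  by (simp_all add: partial_derivs_def)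

lemma smooth_partial_derivs: "smooth f \<Longrightarrow> smooth (partial_derivs js f)"
  by (auto simp: smooth_def simp flip: partial_derivs_simps(3))

lemma partial_deriv_eqI:
  assumes "(g has_derivative D) (at x)"
  shows "partial_deriv i g x = D (axis i 1)"
proof -
  have "(g has_derivative D) (at (x + 0 *\<^sub>R axis i 1))" using assms by simp
  then have "((\<lambda>t. g (x + t *\<^sub>R axis i 1)) has_derivative (\<lambda>t. D (t *\<^sub>R axis i 1))) (at 0)"
    by (rule has_derivative_compose[rotated]) (auto intro!: derivative_eq_intros)
  then have "((\<lambda>t. g (x + t *\<^sub>R axis i 1)) has_vector_derivative D (axis i 1)) (at 0)"
    using assms by (simp add: has_vector_derivative_def linear_cmul has_derivative_linear)
  then show ?thesis by (simp add: partial_deriv_def vector_derivative_at)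
qed

text \<open>Total differentiability is built into \<open>smooth\<close>; a linear map is determined
  by its values on the axes, and there it gives the partial derivatives.\<close>

lemma has_derivative_partial_derivs:
  fixes f :: "real^'n::finite \<Rightarrow> complex"
  assumes "smooth f"
  shows "(partial_derivs is f has_derivative (\<lambda>h. \<Sum>i\<in>UNIV. h $ i *\<^sub>R partial_derivs (i # is) f x)) (at x)"
proof -
  obtain D where D: "(partial_derivs is f has_derivative D) (at x)"
    using assms by (auto simp: smooth_def differentiable_def)
  have D_axis: "D (axis i 1) = partial_derivs (i # is) f x" for i
    by (simp add: partial_derivs_simps partial_deriv_eqI[OF D])
  have "D h = (\<Sum>i\<in>UNIV. h $ i *\<^sub>R partial_derivs (i # is) f x)" for h
  proof -
    have "D h = D (\<Sum>i\<in>UNIV. h $ i *\<^sub>R axis i 1)" by (simp add: scalar_mult_eq_scaleR[symmetric] basis_expansion)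
    also have "\<dots> = (\<Sum>i\<in>UNIV. h $ i *\<^sub>R D (axis i 1))"
      using has_derivative_linear[OF D] by (simp add: linear_sum linear_cmul)
    finally show ?thesis by (simp add: D_axis)
  qed
  then show ?thesis using D by (metis (no_types, lifting) ext)
qed

lemma has_derivative_affine_comp:
  fixes f :: "real^'n::finite \<Rightarrow> complex"
  assumes "smooth f"
  shows "((\<lambda>x. c * partial_derivs is f (r *\<^sub>R x + b)) has_derivative
    (\<lambda>h. c * (\<Sum>i\<in>UNIV. (r * h $ i) *\<^sub>R partial_derivs (i # is) f (r *\<^sub>R x + b)))) (at x)"
proof -
  have "((\<lambda>x. partial_derivs is f (r *\<^sub>R x + b)) has_derivative
      (\<lambda>h. \<Sum>i\<in>UNIV. (r *\<^sub>R h) $ i *\<^sub>R partial_derivs (i # is) f (r *\<^sub>R x + b))) (at x)"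
    by (rule has_derivative_compose[OF _ has_derivative_partial_derivs[OF assms]])
      (auto intro!: derivative_eq_intros)
  then have "((\<lambda>x. c * partial_derivs is f (r *\<^sub>R x + b)) has_derivative
      (\<lambda>h. c * (\<Sum>i\<in>UNIV. (r *\<^sub>R h) $ i *\<^sub>R partial_derivs (i # is) f (r *\<^sub>R x + b)))) (at x)"
    by (rule has_derivative_mult_right)
  then show ?thesis by simp
qed

text \<open>Each differentiation brings out one factor \<open>r\<close>. Scalar multiples are the
  case \<open>r = 1\<close>, \<open>b = 0\<close>, which is how \<open>schwartz_cmult\<close> uses
  this.\<close>

lemma partial_derivs_affine:
  fixes f :: "real^'n::finite \<Rightarrow> complex"
  assumes "smooth f"
  shows "partial_derivs is (\<lambda>x. c * f (r *\<^sub>R x + b)) =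
    (\<lambda>x. (c * of_real r ^ length is) * partial_derivs is f (r *\<^sub>R x + b))"
proof (induction "is")
  case Nil
  then show ?case by (simp add: partial_derivs_simps)
next
  case (Cons i "is")
  show ?case
    \<comment> \<open>The instantiation unfolds the left side only; the right side keeps
      \<open>partial_derivs (i # is) f\<close>, the form that
      \<open>has_derivative_affine_comp\<close> produces.\<close>
    unfolding partial_derivs_simps(2)[of i "is" "\<lambda>x. c * f (r *\<^sub>R x + b)"] Cons.IH
    by (rule ext, subst partial_deriv_eqI[OF has_derivative_affine_comp[OF assms]])
      (simp add: axis_def if_distrib if_distribR sum.delta' scaleR_conv_of_real mult_ac cong: if_cong)
qed

lemma smooth_affine:
  fixes f :: "real^'n::finite \<Rightarrow> complex"
  assumes "smooth f"
  shows "smooth (\<lambda>x. c * f (r *\<^sub>R x + b))"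
  unfolding smooth_def partial_derivs_affine[OF assms] differentiable_def
  using has_derivative_affine_comp[OF assms] by blast

lemma partial_derivs_add:
  fixes f g :: "real^'n::finite \<Rightarrow> complex"
  assumes "smooth f" "smooth g"
  shows "partial_derivs is (\<lambda>x. f x + g x) = (\<lambda>x. partial_derivs is f x + partial_derivs is g x)"
proof (induction "is")
  case Nil
  then show ?case by (simp add: partial_derivs_simps)
next
  case (Cons i "is")
  show ?case
    unfolding partial_derivs_simps(2)[of i "is" "\<lambda>x. f x + g x"] Cons.IH
    by (rule ext, subst partial_deriv_eqI[OF has_derivative_add[OF has_derivative_partial_derivs[OF assms(1)]
            has_derivative_partial_derivs[OF assms(2)]]])
      (simp add: axis_def if_distrib if_distribR sum.delta' cong: if_cong)
qed

lemma smooth_add: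
  fixes f g :: "real^'n::finite \<Rightarrow> complex"
  assumes "smooth f" "smooth g"
  shows "smooth (\<lambda>x. f x + g x)"
  using assms by (simp add: smooth_def partial_derivs_add[OF assms] differentiable_add)

lemma smooth_continuous:
  fixes f :: "real^'n::finite \<Rightarrow> complex"
  assumes "smooth f" shows "continuous_on A (partial_derivs is f)"
  using assms unfolding smooth_def
  by (meson continuous_at_imp_continuous_on differentiable_imp_continuous_within)

section \<open>Schwartz functions and their seminorms\<close>

lemma schwartz_smooth: "f \<in> schwartz \<Longrightarrow> smooth f"
  by (simp add: schwartz_def)

text \<open>The seminorm is a supremum in the reals, which is an upper bound only for a bounded
  family; membership in \<open>schwartz\<close> supplies that.\<close>

lemma schwartz_bdd_above:
  assumes "f \<in> schwartz"
  shows "bdd_above (range (\<lambda>x. norm (monomial \<alpha> x *\<^sub>R partial_derivs is f x)))"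
  using assms unfolding schwartz_def bounded_iff bdd_above_def by fast

lemma norm_le_schwartz_seminorm:
  assumes "f \<in> schwartz"
  shows "norm (monomial \<alpha> x *\<^sub>R partial_derivs is f x) \<le> schwartz_seminorm \<alpha> is f"
  unfolding schwartz_seminorm_def using schwartz_bdd_above[OF assms] by (rule cSUP_upper[OF UNIV_I])

lemma schwartz_seminorm_le:
  assumes "\<And>x. norm (monomial \<alpha> x *\<^sub>R partial_derivs is f x) \<le> B"
  shows "schwartz_seminorm \<alpha> is f \<le> B"
  unfolding schwartz_seminorm_def using assms by (intro cSUP_least) auto

lemma schwartz_seminorm_nonneg: "f \<in> schwartz \<Longrightarrow> 0 \<le> schwartz_seminorm \<alpha> is f"
  using norm_le_schwartz_seminorm order_trans norm_ge_zero by blast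

lemma schwartzI:
  assumes "smooth f" "\<And>\<alpha> is. \<exists>B. \<forall>x. norm (monomial \<alpha> x *\<^sub>R partial_derivs is f x) \<le> B"
  shows "f \<in> schwartz"
  using assms by (simp add: schwartz_def bounded_iff)

lemma schwartz_add:
  assumes f: "f \<in> schwartz" and g: "g \<in> schwartz"
  shows "(\<lambda>x. f x + g x) \<in> schwartz"
    and "schwartz_seminorm \<alpha> is (\<lambda>x. f x + g x) \<le> schwartz_seminorm \<alpha> is f + schwartz_seminorm \<alpha> is g"
proof -
  have *: "norm (monomial \<alpha> x *\<^sub>R partial_derivs is (\<lambda>x. f x + g x) x)
      \<le> schwartz_seminorm \<alpha> is f + schwartz_seminorm \<alpha> is g" for \<alpha> "is" x
    unfolding partial_derivs_add[OF schwartz_smooth[OF f] schwartz_smooth[OF g]] scaleR_add_right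
    by (rule order_trans[OF norm_triangle_ineq add_mono[OF norm_le_schwartz_seminorm[OF f] norm_le_schwartz_seminorm[OF g]]])
  show "(\<lambda>x. f x + g x) \<in> schwartz"
    using * by (intro schwartzI[OF smooth_add[OF schwartz_smooth[OF f] schwartz_smooth[OF g]]]) blast
  show "schwartz_seminorm \<alpha> is (\<lambda>x. f x + g x) \<le> schwartz_seminorm \<alpha> is f + schwartz_seminorm \<alpha> is g"
    using * by (rule schwartz_seminorm_le)
qed

lemma schwartz_cmult:
  assumes f: "f \<in> schwartz"
  shows "(\<lambda>x. c * f x) \<in> schwartz"
    and "schwartz_seminorm \<alpha> is (\<lambda>x. c * f x) \<le> norm c * schwartz_seminorm \<alpha> is f"
proof -
  have *: "norm (monomial \<alpha> x *\<^sub>R partial_derivs is (\<lambda>x. c * f x) x) \<le> norm c * schwartz_seminorm \<alpha> is f" for \<alpha> "is" x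
    using partial_derivs_affine[OF schwartz_smooth[OF f], of "is" c 1 0]
      mult_left_mono[OF norm_le_schwartz_seminorm[OF f, of \<alpha> x "is"], of "norm c"]
    by (simp add: norm_mult mult_ac)
  show "(\<lambda>x. c * f x) \<in> schwartz"
    using * smooth_affine[OF schwartz_smooth[OF f], of c 1 0] by (intro schwartzI) auto
  show "schwartz_seminorm \<alpha> is (\<lambda>x. c * f x) \<le> norm c * schwartz_seminorm \<alpha> is f"
    using * by (rule schwartz_seminorm_le)
qed

lemma schwartz_diff:
  assumes f: "f \<in> schwartz" and g: "g \<in> schwartz"
  shows "(\<lambda>x. f x - g x) \<in> schwartz"
  using schwartz_add(1)[OF f schwartz_cmult(1)[OF g, of "-1"]] by simp

text \<open>One increasing family in place of all seminorms: any finitely many of them are dominated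
  by a single \<open>schwartz_norm N\<close>. Both index sets are finite, the multi-indices forming
  a box.\<close>

definition schwartz_norm :: "nat \<Rightarrow> (real^'n::finite \<Rightarrow> complex) \<Rightarrow> real"
  where "schwartz_norm N f =
    (\<Sum>is | length is \<le> N. \<Sum>\<alpha> | \<forall>i. \<alpha> i \<le> N. schwartz_seminorm \<alpha> is f)"

lemma finite_lists_le: "finite {is :: 'n::finite list. length is \<le> N}"
  using finite_lists_length_le[of "UNIV :: 'n set" N] by simp

lemma finite_multi_indices_le: "finite {\<alpha> :: 'n::finite \<Rightarrow> nat. \<forall>i. \<alpha> i \<le> N}"
  using finite_PiE[of "UNIV :: 'n set" "\<lambda>_. {..N}"] by (simp add: PiE_def Pi_def)

lemma schwartz_norm_nonneg: "f \<in> schwartz \<Longrightarrow> 0 \<le> schwartz_norm N f"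
  unfolding schwartz_norm_def by (intro sum_nonneg schwartz_seminorm_nonneg)

lemma schwartz_seminorm_le_norm:
  assumes f: "f \<in> schwartz" and "length is \<le> N" "\<And>i. \<alpha> i \<le> N"
  shows "schwartz_seminorm \<alpha> is f \<le> schwartz_norm N f"
proof -
  have "schwartz_seminorm \<alpha> is f \<le> (\<Sum>\<alpha> | \<forall>i. \<alpha> i \<le> N. schwartz_seminorm \<alpha> is f)"
    using assms by (intro member_le_sum) (auto simp: finite_multi_indices_le schwartz_seminorm_nonneg)
  also have "\<dots> \<le> schwartz_norm N f"
    unfolding schwartz_norm_def using assms
    by (intro member_le_sum[of "is" _ "\<lambda>is. \<Sum>\<alpha> | \<forall>i. \<alpha> i \<le> N. schwartz_seminorm \<alpha> is f"])
       (auto simp: finite_lists_le intro!: sum_nonneg schwartz_seminorm_nonneg)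
  finally show ?thesis .
qed

lemma schwartz_norm_mono:
  fixes f :: "real^'n::finite \<Rightarrow> complex"
  assumes f: "f \<in> schwartz" and "M \<le> N"
  shows "schwartz_norm M f \<le> schwartz_norm N f"
proof -
  have "schwartz_norm M f \<le> (\<Sum>is | length is \<le> M. \<Sum>\<alpha> | \<forall>i. \<alpha> i \<le> N. schwartz_seminorm \<alpha> is f)"
    unfolding schwartz_norm_def using assms
    by (intro sum_mono sum_mono2) (auto simp: finite_multi_indices_le schwartz_seminorm_nonneg intro: order_trans)
  also have "\<dots> \<le> schwartz_norm N f"
    unfolding schwartz_norm_def using assms
    by (intro sum_mono2) (auto simp: finite_lists_le intro!: sum_nonneg schwartz_seminorm_nonneg)
  finally show ?thesis .
qed

lemma schwartz_norm_cmult: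
  assumes f: "f \<in> schwartz"
  shows "schwartz_norm N (\<lambda>x. c * f x) \<le> norm c * schwartz_norm N f"
  unfolding schwartz_norm_def sum_distrib_left
  by (intro sum_mono schwartz_cmult(2) f)

text \<open>The weights \<open>(1 + |x|)^N\<close> and the monomials define the same seminorms up to constants.\<close>

lemma norm_monomial_le: "\<bar>monomial \<alpha> x\<bar> \<le> (1 + norm x) ^ (\<Sum>i\<in>UNIV. \<alpha> i)" for x :: "real^'n::finite"
proof -
  have "\<bar>monomial \<alpha> x\<bar> = (\<Prod>i\<in>UNIV. \<bar>x $ i\<bar> ^ \<alpha> i)"
    by (simp add: monomial_def abs_prod power_abs)
  also have "\<dots> \<le> (\<Prod>i\<in>UNIV. (1 + norm x) ^ \<alpha> i)"
    using component_le_norm_cart[of x]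
    by (intro prod_mono conjI power_mono zero_le_power) (auto intro: order_trans[OF _ le_add_same_cancel2[THEN iffD2]])
  finally show ?thesis by (simp add: power_sum)
qed

text \<open>If the coordinate \<open>x $ i\<close> is largest in modulus, then
  \<open>1 + norm x\<close> is at most \<open>2 * CARD('n)\<close> times the maximum of 1 and
  \<open>|x $ i|\<close>. Summing over all \<open>i\<close> makes the bound independent of which
  coordinate that is.\<close>

lemma weight_le_monomials:
  fixes x :: "real^'n::finite"
  shows "(1 + norm x) ^ N \<le> (2 * real CARD('n)) ^ N *
    (1 + (\<Sum>i\<in>UNIV. \<bar>monomial (\<lambda>j. if j = i then N else 0) x\<bar>))"
proof -
  obtain i where i: "\<And>j. \<bar>x $ j\<bar> \<le> \<bar>x $ i\<bar>"
  proof -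
    have "\<exists>i. \<forall>j. \<bar>x $ j\<bar> \<le> \<bar>x $ i\<bar>"
      using Max_ge[of "range (\<lambda>j. \<bar>x $ j\<bar>)"] Max_in[of "range (\<lambda>j. \<bar>x $ j\<bar>)"] by fastforce
    then show ?thesis using that by blast
  qed
  have n1: "1 \<le> real CARD('n)" by (simp add: Suc_leI)
  have "norm x \<le> (\<Sum>j\<in>UNIV. \<bar>x $ j\<bar>)" by (rule norm_le_l1_cart)
  also have "\<dots> \<le> (\<Sum>j\<in>(UNIV :: 'n set). \<bar>x $ i\<bar>)" by (intro sum_mono i)
  finally have nx: "norm x \<le> real CARD('n) * \<bar>x $ i\<bar>" by simp
  have mono_eq: "\<bar>monomial (\<lambda>j. if j = i then N else 0) x\<bar> = \<bar>x $ i\<bar> ^ N"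
    by (simp add: monomial_def power_abs if_distrib prod.delta cong: if_cong)
  have "1 + norm x \<le> 2 * real CARD('n) * max 1 \<bar>x $ i\<bar>"
    using nx n1 mult_left_mono[of "1" "max 1 \<bar>x $ i\<bar>" "real CARD('n)"]
      mult_left_mono[of "\<bar>x $ i\<bar>" "max 1 \<bar>x $ i\<bar>" "real CARD('n)"] by linarith
  then have "(1 + norm x) ^ N \<le> (2 * real CARD('n) * max 1 \<bar>x $ i\<bar>) ^ N"
    by (intro power_mono) auto
  also have "\<dots> = (2 * real CARD('n)) ^ N * (max 1 \<bar>x $ i\<bar>) ^ N" by (simp add: power_mult_distrib)
  also have "(max 1 \<bar>x $ i\<bar>) ^ N \<le> 1 + \<bar>x $ i\<bar> ^ N" by (auto simp: max_def)
  also have "\<bar>x $ i\<bar> ^ N \<le> (\<Sum>i\<in>UNIV. \<bar>monomial (\<lambda>j. if j = i then N else 0) x\<bar>)"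
    unfolding mono_eq[symmetric]
    by (rule member_le_sum[of i UNIV "\<lambda>i. \<bar>monomial (\<lambda>j. if j = i then N else 0) x\<bar>"]) auto
  finally show ?thesis by (simp add: mult_left_mono)
qed

text \<open>The constant depends only on \<open>N\<close> and the dimension. Uniformity in
  \<open>f\<close> is what later makes the sum over cubes continuous in \<open>h\<close>.\<close>

lemma schwartz_decay:
  fixes N :: nat
  obtains C where "0 \<le> C" "\<And>f is (x :: real^'n::finite). f \<in> schwartz \<Longrightarrow> length is \<le> N \<Longrightarrow>
    (1 + norm x) ^ N * norm (partial_derivs is f x) \<le> C * schwartz_norm N f"
proof
  define C where "C = (2 * real CARD('n)) ^ N * (1 + real CARD('n))"
  show "0 \<le> C" by (simp add: C_def)
  fix f :: "real^'n \<Rightarrow> complex" and "is" :: "'n list" and x :: "real^'n"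
  assume f: "f \<in> schwartz" and l: "length is \<le> N"
  define D where "D = norm (partial_derivs is f x)"
  have m: "\<bar>monomial \<alpha> x\<bar> * D \<le> schwartz_norm N f" if "\<And>i. \<alpha> i \<le> N" for \<alpha>
    using order_trans[OF norm_le_schwartz_seminorm[OF f, of \<alpha> x "is"] schwartz_seminorm_le_norm[OF f l that]]
    by (simp add: D_def)
  have "(1 + norm x) ^ N * D \<le> (2 * real CARD('n)) ^ N *
      (1 + (\<Sum>i\<in>UNIV. \<bar>monomial (\<lambda>j. if j = i then N else 0) x\<bar>)) * D"
    by (intro mult_right_mono weight_le_monomials) (auto simp: D_def)
  also have "\<dots> = (2 * real CARD('n)) ^ N *
      (\<bar>monomial (\<lambda>_. 0) x\<bar> * D + (\<Sum>i\<in>UNIV. \<bar>monomial (\<lambda>j. if j = i then N else 0) x\<bar> * D))"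
    by (simp add: monomial_def algebra_simps sum_distrib_left sum_distrib_right)
  also have "\<dots> \<le> (2 * real CARD('n)) ^ N * (schwartz_norm N f + (\<Sum>i\<in>(UNIV :: 'n set). schwartz_norm N f))"
    by (intro mult_left_mono add_mono sum_mono m) auto
  also have "\<dots> = C * schwartz_norm N f" by (simp add: C_def algebra_simps)
  finally show "(1 + norm x) ^ N * norm (partial_derivs is f x) \<le> C * schwartz_norm N f"
    by (simp add: D_def)
qed

text \<open>A converse to \<open>schwartz_decay\<close>. The exponent \<open>N * CARD('n)\<close> is
  the largest total degree of a multi-index with all entries at most \<open>N\<close>.\<close>

lemma schwartz_normI:
  "\<exists>C\<ge>0. \<forall>f B. (\<forall>is (x :: real^'n::finite). length is \<le> N \<longrightarrow>
    (1 + norm x) ^ (N * CARD('n)) * norm (partial_derivs is f x) \<le> B) \<longrightarrow> schwartz_norm N f \<le> C * B"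
proof -
  define C where "C = real (card {is :: 'n list. length is \<le> N}) * card {\<alpha> :: 'n \<Rightarrow> nat. \<forall>i. \<alpha> i \<le> N}"
  have "schwartz_norm N f \<le> C * B" if B: "\<And>is (x :: real^'n). length is \<le> N \<Longrightarrow>
    (1 + norm x) ^ (N * CARD('n)) * norm (partial_derivs is f x) \<le> B" for f B
  proof -
  have "schwartz_seminorm \<alpha> is f \<le> B" if "length is \<le> N" "\<forall>i. \<alpha> i \<le> N" for \<alpha> "is"
  proof (rule schwartz_seminorm_le)
    fix x :: "real^'n"
    have "(\<Sum>i\<in>UNIV. \<alpha> i) \<le> N * CARD('n)"
      using sum_bounded_above[of UNIV \<alpha> N] that by (simp add: mult.commute)
    then have "\<bar>monomial \<alpha> x\<bar> \<le> (1 + norm x) ^ (N * CARD('n))"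
      by (intro order_trans[OF norm_monomial_le power_increasing]) auto
    then have "\<bar>monomial \<alpha> x\<bar> * norm (partial_derivs is f x)
        \<le> (1 + norm x) ^ (N * CARD('n)) * norm (partial_derivs is f x)"
      by (rule mult_right_mono) simp
    then show "norm (monomial \<alpha> x *\<^sub>R partial_derivs is f x) \<le> B"
      using B[OF that(1), of x] by simp
  qed
  then have "schwartz_norm N f \<le> (\<Sum>is :: 'n list | length is \<le> N. \<Sum>\<alpha> :: 'n \<Rightarrow> nat | \<forall>i. \<alpha> i \<le> N. B)"
    unfolding schwartz_norm_def by (intro sum_mono) auto
  then show ?thesis by (simp add: C_def)
  qed
  moreover have "0 \<le> C" by (simp add: C_def)
  ultimately show ?thesis by blast
qed

text \<open>Solving for \<open>x\<close> costs a factor \<open>1 / r\<close> and an additive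
  \<open>norm b\<close>. The product form is chosen so that powers of the bound split into separate
  factors.\<close>

lemma norm_affine_ge:
  fixes x b :: "'a::real_normed_vector"
  assumes "0 < r"
  shows "1 + norm x \<le> (1 + 1 / r) * (1 + norm b) * (1 + norm (r *\<^sub>R x + b))"
proof -
  have "r * norm x = norm (r *\<^sub>R x)" using assms by simp
  also have "\<dots> \<le> norm (r *\<^sub>R x + b) + norm b"
    using norm_triangle_ineq4[of "r *\<^sub>R x + b" b] by simp
  also have "\<dots> \<le> (1 + norm b) * (1 + norm (r *\<^sub>R x + b))" by (simp add: algebra_simps)
  finally have "norm x \<le> 1 / r * ((1 + norm b) * (1 + norm (r *\<^sub>R x + b)))"
    using assms by (simp add: field_simps)
  moreover have "1 \<le> (1 + norm b) * (1 + norm (r *\<^sub>R x + b))" by (simp add: algebra_simps add_increasing)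
  ultimately have "1 + norm x \<le> (1 + norm b) * (1 + norm (r *\<^sub>R x + b))
      + 1 / r * ((1 + norm b) * (1 + norm (r *\<^sub>R x + b)))" by linarith
  also have "\<dots> = (1 + 1 / r) * (1 + norm b) * (1 + norm (r *\<^sub>R x + b))"
    by (simp only: distrib_right mult_1_left mult.assoc)
  finally show ?thesis .
qed

text \<open>All dependence on \<open>r\<close>, \<open>b\<close> and \<open>c\<close> is explicit:
  the weight in \<open>x\<close> is compared with the weight at \<open>r x + b\<close> by
  \<open>norm_affine_ge\<close>, and the derivatives contribute at most \<open>(1 + r) ^ L\<close>,
  which covers small and large \<open>r\<close> alike.\<close>

lemma schwartz_affine_decay:
  fixes f :: "real^'n::finite \<Rightarrow> complex"
  assumes f: "f \<in> schwartz"
  obtains C where "0 \<le> C"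
    "\<And>r b c is x. 0 < r \<Longrightarrow> length is \<le> L \<Longrightarrow> (1 + norm x) ^ L * norm (partial_derivs is (\<lambda>x. c * f (r *\<^sub>R x + b)) x)
     \<le> C * (norm c * ((1 + 1 / r) * (1 + norm b)) ^ L * (1 + r) ^ L)"
proof -
  obtain C where C: "0 \<le> C" "\<And>g is (x :: real^'n). g \<in> schwartz \<Longrightarrow> length is \<le> L \<Longrightarrow>
    (1 + norm x) ^ L * norm (partial_derivs is g x) \<le> C * schwartz_norm L g"
    by (rule schwartz_decay[of L]) (rule that)
  have "(1 + norm x) ^ L * norm (partial_derivs is (\<lambda>x. c * f (r *\<^sub>R x + b)) x)
     \<le> (C * schwartz_norm L f) * (norm c * ((1 + 1 / r) * (1 + norm b)) ^ L * (1 + r) ^ L)"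
    if r: "0 < r" and l: "length is \<le> L" for r b c "is" x
  proof -
    define y where "y = r *\<^sub>R x + b"
    define A where "A = (1 + 1 / r) * (1 + norm b)"
    have A: "0 \<le> A" using r by (simp add: A_def)
    have "(1 + norm x) ^ L \<le> (A * (1 + norm y)) ^ L"
      using norm_affine_ge[OF r, of x b] by (intro power_mono) (auto simp: A_def y_def)
    moreover have "r ^ length is \<le> (1 + r) ^ L"
      using r l by (intro order_trans[OF power_mono power_increasing]) auto
    ultimately have "(1 + norm x) ^ L * (norm c * r ^ length is * norm (partial_derivs is f y))
        \<le> (A * (1 + norm y)) ^ L * (norm c * (1 + r) ^ L * norm (partial_derivs is f y))"
      using r A by (intro mult_mono mult_nonneg_nonneg zero_le_power mult_left_mono mult_right_mono) auto
    also have "\<dots> = (norm c * A ^ L * (1 + r) ^ L) * ((1 + norm y) ^ L * norm (partial_derivs is f y))"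
      by (simp add: power_mult_distrib)
    also have "\<dots> \<le> (norm c * A ^ L * (1 + r) ^ L) * (C * schwartz_norm L f)"
      using r A by (intro mult_left_mono C f l) auto
    finally show ?thesis
      using r by (simp add: partial_derivs_affine[OF schwartz_smooth[OF f]] y_def[symmetric] A_def norm_mult norm_power mult_ac)
  qed
  then show ?thesis
    using that[of "C * schwartz_norm L f"] C(1) schwartz_norm_nonneg[OF f] by simp
qed

lemma schwartz_affine:
  fixes f :: "real^'n::finite \<Rightarrow> complex"
  assumes f: "f \<in> schwartz" and r: "0 < r"
  shows "(\<lambda>x. c * f (r *\<^sub>R x + b)) \<in> schwartz"
proof (rule schwartzI)
  show "smooth (\<lambda>x. c * f (r *\<^sub>R x + b))" by (rule smooth_affine[OF schwartz_smooth[OF f]])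
  fix \<alpha> :: "'n \<Rightarrow> nat" and "is" :: "'n list"
  \<comment> \<open>One exponent serves in \<open>schwartz_affine_decay\<close> for weight and
    derivatives, so \<open>L\<close> has to dominate both the degree of the monomial and the length
    of the list.\<close>
  define L where "L = (\<Sum>i\<in>UNIV. \<alpha> i) + length is"
  obtain C where "0 \<le> C" and C: "\<And>r b c is x. 0 < r \<Longrightarrow> length is \<le> L \<Longrightarrow>
     (1 + norm x) ^ L * norm (partial_derivs is (\<lambda>x. c * f (r *\<^sub>R x + b)) x)
     \<le> C * (norm c * ((1 + 1 / r) * (1 + norm b)) ^ L * (1 + r) ^ L)"
    by (rule schwartz_affine_decay[OF f, of L]) (rule that)
  have "norm (monomial \<alpha> x *\<^sub>R partial_derivs is (\<lambda>x. c * f (r *\<^sub>R x + b)) x)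
      \<le> C * (norm c * ((1 + 1 / r) * (1 + norm b)) ^ L * (1 + r) ^ L)" for x
  proof -
    have "\<bar>monomial \<alpha> x\<bar> \<le> (1 + norm x) ^ L"
      by (intro order_trans[OF norm_monomial_le power_increasing]) (auto simp: L_def)
    then have "norm (monomial \<alpha> x *\<^sub>R partial_derivs is (\<lambda>x. c * f (r *\<^sub>R x + b)) x)
       \<le> (1 + norm x) ^ L * norm (partial_derivs is (\<lambda>x. c * f (r *\<^sub>R x + b)) x)"
      by (simp add: mult_right_mono)
    also have "\<dots> \<le> C * (norm c * ((1 + 1 / r) * (1 + norm b)) ^ L * (1 + r) ^ L)"
      by (rule C[OF r]) (simp add: L_def)
    finally show ?thesis .
  qed
  then show "\<exists>B. \<forall>x. norm (monomial \<alpha> x *\<^sub>R partial_derivs is (\<lambda>x. c * f (r *\<^sub>R x + b)) x) \<le> B"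
    by blast
qed

text \<open>With \<open>r = 2^\<nu>\<close> and \<open>b = -k\<close> this turns a seminorm bound on
  a distribution into polynomial growth of its values on dilates.\<close>

lemma schwartz_norm_affine:
  fixes f :: "real^'n::finite \<Rightarrow> complex"
  assumes f: "f \<in> schwartz"
  obtains C L where "0 \<le> C" "\<And>r b c. 0 < r \<Longrightarrow> schwartz_norm N (\<lambda>x. c * f (r *\<^sub>R x + b))
     \<le> C * (norm c * ((1 + 1 / r) * (1 + norm b)) ^ L * (1 + r) ^ L)"
proof -
  define L where "L = N * CARD('n)"
  obtain C1 where C1: "0 \<le> C1"
    "\<And>r b c is x. 0 < r \<Longrightarrow> length is \<le> L \<Longrightarrow> (1 + norm x) ^ L * norm (partial_derivs is (\<lambda>x. c * f (r *\<^sub>R x + b)) x)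
     \<le> C1 * (norm c * ((1 + 1 / r) * (1 + norm b)) ^ L * (1 + r) ^ L)"
    by (rule schwartz_affine_decay[OF f, of L]) (rule that)
  obtain C2 where C2: "0 \<le> C2" "\<forall>f B. (\<forall>is (x :: real^'n). length is \<le> N \<longrightarrow>
    (1 + norm x) ^ L * norm (partial_derivs is f x) \<le> B) \<longrightarrow> schwartz_norm N f \<le> C2 * B"
    using schwartz_normI[of N, where 'n='n] unfolding L_def by blast
  have "N \<le> L" by (simp add: L_def)
  have "schwartz_norm N (\<lambda>x. c * f (r *\<^sub>R x + b))
     \<le> C2 * (C1 * (norm c * ((1 + 1 / r) * (1 + norm b)) ^ L * (1 + r) ^ L))" if "0 < r" for r b c
    by (rule C2(2)[rule_format]) (use C1(2)[OF that] \<open>N \<le> L\<close> in auto)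
  then show ?thesis using that[of "C2 * C1" L] C1(1) C2(1) by (simp add: mult_ac)
qed

section \<open>The Schwartz topology\<close>

lemma schwartz_zero: "(\<lambda>x :: real^'n::finite. 0) \<in> schwartz"
proof -
  have "partial_derivs is (\<lambda>x. 0) = (\<lambda>x. 0)" for "is" :: "'n::finite list"
    by (induction "is") (simp_all add: partial_derivs_simps partial_deriv_eqI[OF has_derivative_const])
  then show ?thesis by (simp add: schwartz_def smooth_def)
qed

lemma topspace_schwartz: "topspace schwartz_topology = (schwartz :: (real^'n::finite \<Rightarrow> complex) set)"
proof -
  \<comment> \<open>Each function lies in a generating set centred at itself; the radius exceeds the
    seminorm of the zero function by 1, so that seminorm need not be computed.\<close>
  have ex: "\<exists>\<alpha> is f0 e. f \<in> {g \<in> schwartz. schwartz_seminorm \<alpha> is (\<lambda>x. g x - f0 x) < e} \<and> f0 \<in> schwartz \<and> 0 < e"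
    if "f \<in> schwartz" for f :: "real^'n \<Rightarrow> complex"
    using that schwartz_seminorm_nonneg[OF schwartz_zero, of "\<lambda>_ :: 'n. 0" "[]"]
    by (intro exI[of _ "\<lambda>_ :: 'n. 0 :: nat"] exI[of _ "[]"] exI[of _ f]
        exI[of _ "schwartz_seminorm (\<lambda>_. 0) [] (\<lambda>x :: real^'n. 0) + 1"]) (auto simp: add_nonneg_pos)
  then show ?thesis
    unfolding schwartz_topology_def topology_generated_by_topspace
  proof (intro subset_antisym subsetI)
    fix f :: "real^'n \<Rightarrow> complex" assume "f \<in> schwartz"
    with ex obtain \<alpha> "is" f0 e where f: "f \<in> {g \<in> schwartz. schwartz_seminorm \<alpha> is (\<lambda>x. g x - f0 x) < e}"
      "f0 \<in> schwartz" "0 < e" by meson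
    show "f \<in> \<Union>{{g \<in> schwartz. schwartz_seminorm \<alpha> is (\<lambda>x. g x - f x) < e} |\<alpha> is f e. f \<in> schwartz \<and> 0 < e}"
      by (rule UnionI[OF _ f(1)], intro CollectI exI conjI) (rule refl f)+
  qed auto
qed

text \<open>Induction on the generation of open sets. An intersection takes the larger of the two
  indices, by monotonicity of \<open>schwartz_norm\<close>; a generating set may be centred away
  from \<open>f\<close>, and the triangle inequality moves the centre.\<close>

lemma openin_schwartz_topologyD:
  fixes f :: "real^'n::finite \<Rightarrow> complex"
  assumes "openin schwartz_topology U" "f \<in> U"
  shows "\<exists>N. \<exists>\<epsilon>>0. \<forall>g\<in>schwartz. schwartz_norm N (\<lambda>x. g x - f x) < \<epsilon> \<longrightarrow> g \<in> U"
  using openin_topology_generated_by[OF assms(1)[unfolded schwartz_topology_def]] assms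
proof (induction rule: generate_topology_on.induct)
  case Empty
  then show ?case by simp
next
  case (Int a b)
  have "openin schwartz_topology a" "openin schwartz_topology b"
    using Int.hyps by (simp_all add: schwartz_topology_def openin_topology_generated_by_iff)
  with Int obtain M N \<delta> \<epsilon> where MN: "0 < \<delta>" "0 < \<epsilon>"
    "\<forall>g\<in>schwartz. schwartz_norm M (\<lambda>x. g x - f x) < \<delta> \<longrightarrow> g \<in> a"
    "\<forall>g\<in>schwartz. schwartz_norm N (\<lambda>x. g x - f x) < \<epsilon> \<longrightarrow> g \<in> b"
    by blast
  have f: "f \<in> schwartz"
    using openin_subset[OF \<open>openin schwartz_topology a\<close>] Int.prems by (auto simp: topspace_schwartz)
  have "g \<in> a \<inter> b" if g: "g \<in> schwartz" and l: "schwartz_norm (max M N) (\<lambda>x. g x - f x) < min \<delta> \<epsilon>" for g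
    using MN g l schwartz_norm_mono[OF schwartz_diff[OF g f], of M "max M N"]
      schwartz_norm_mono[OF schwartz_diff[OF g f], of N "max M N"] by fastforce
  then show ?case using MN(1,2) by (intro exI[of _ "max M N"] exI[of _ "min \<delta> \<epsilon>"]) auto
next
  case (UN K)
  then obtain k where k: "k \<in> K" "f \<in> k" by blast
  have "openin schwartz_topology k"
    using UN.hyps k by (simp add: schwartz_topology_def openin_topology_generated_by_iff)
  with UN.IH[OF k(1) this k(2)] k show ?case by blast
next
  case (Basis s)
  then obtain \<alpha> "is" f0 e where s: "s = {g \<in> schwartz. schwartz_seminorm \<alpha> is (\<lambda>x. g x - f0 x) < e}" "f0 \<in> schwartz"
    by blast
  have f: "f \<in> schwartz" "schwartz_seminorm \<alpha> is (\<lambda>x. f x - f0 x) < e" using Basis.prems s by auto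
  define N where "N = length is + (\<Sum>i\<in>UNIV. \<alpha> i)"
  have \<alpha>: "\<alpha> i \<le> N" for i using member_le_sum[of i UNIV \<alpha>] by (simp add: N_def trans_le_add2)
  show ?case
  \<comment> \<open>The radius is what is left of \<open>e\<close> after moving the centre from
    \<open>f0\<close> to \<open>f\<close>.\<close>
  proof (intro exI[of _ N] exI[of _ "e - schwartz_seminorm \<alpha> is (\<lambda>x. f x - f0 x)"] conjI ballI impI)
    fix g :: "real^'n \<Rightarrow> complex"
    assume g: "g \<in> schwartz" "schwartz_norm N (\<lambda>x. g x - f x) < e - schwartz_seminorm \<alpha> is (\<lambda>x. f x - f0 x)"
    have "schwartz_seminorm \<alpha> is (\<lambda>x. g x - f0 x)
        \<le> schwartz_seminorm \<alpha> is (\<lambda>x. g x - f x) + schwartz_seminorm \<alpha> is (\<lambda>x. f x - f0 x)"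
      using schwartz_add(2)[OF schwartz_diff[OF g(1) f(1)] schwartz_diff[OF f(1) s(2)]] by simp
    also have "schwartz_seminorm \<alpha> is (\<lambda>x. g x - f x) \<le> schwartz_norm N (\<lambda>x. g x - f x)"
      by (rule schwartz_seminorm_le_norm[OF schwartz_diff[OF g(1) f(1)] _ \<alpha>]) (simp add: N_def)
    finally show "g \<in> s" using g s by simp
  qed (use f in auto)
qed

text \<open>Continuity at zero keeps \<open>u\<close> in the unit ball on some
  \<open>schwartz_norm\<close> ball, and homogeneity extends this to all \<open>h\<close>. A
  counterexample is rescaled by \<open>norm (u h)\<close>, which is then positive, so there is no
  division by the norm of \<open>h\<close>.\<close>

lemma tempered_distribution_bound:
  fixes u :: "(real^'n::finite \<Rightarrow> complex) \<Rightarrow> complex"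
  assumes "u \<in> tempered_distributions"
  obtains C N where "0 \<le> C" "\<And>h. h \<in> schwartz \<Longrightarrow> norm (u h) \<le> C * schwartz_norm N h"
proof -
  have lin: "\<And>c f. f \<in> schwartz \<Longrightarrow> u (\<lambda>x. c * f x) = cnj c * u f"
    and cont: "continuous_map schwartz_topology euclidean u"
    using assms by (auto simp: tempered_distributions_def antilinear_on_def)
  have u0: "u (\<lambda>x. 0) = 0" using lin[OF schwartz_zero, of 0] by simp
  define U where "U = {f \<in> schwartz. u f \<in> ball 0 1}"
  have "openin schwartz_topology U"
    using cont unfolding continuous_map_def topspace_schwartz U_def open_openin[symmetric] by blast
  moreover have "(\<lambda>x. 0) \<in> U" by (simp add: U_def schwartz_zero u0)
  ultimately obtain N \<epsilon> where N: "0 < \<epsilon>" "\<forall>g\<in>schwartz. schwartz_norm N (\<lambda>x. g x - 0) < \<epsilon> \<longrightarrow> g \<in> U"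
    using openin_schwartz_topologyD by blast
  have "norm (u h) \<le> (1 / \<epsilon>) * schwartz_norm N h" if h: "h \<in> schwartz" for h
  proof (rule ccontr)
    assume "\<not> ?thesis"
    then have a: "schwartz_norm N h < \<epsilon> * norm (u h)" using N(1) by (simp add: field_simps)
    then have u: "0 < norm (u h)" using schwartz_norm_nonneg[OF h, of N] N(1) zero_less_mult_pos[of \<epsilon>]
      by (metis order_le_less_trans)
    define c where "c = complex_of_real (1 / norm (u h))"
    have "schwartz_norm N (\<lambda>x. c * h x) \<le> norm c * schwartz_norm N h" by (rule schwartz_norm_cmult[OF h])
    also have "\<dots> < \<epsilon>" using a u by (simp add: c_def field_simps norm_divide)
    finally have "(\<lambda>x. c * h x) \<in> U" using N(2) schwartz_cmult(1)[OF h] by simp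
    then have "norm (cnj c * u h) < 1" using lin[OF h] by (simp add: U_def)
    then show False using u by (simp add: c_def norm_mult norm_divide)
  qed
  then show ?thesis using that[of "1 / \<epsilon>" N] N(1) by simp
qed

text \<open>Generating sets control one seminorm at a time, so the neighbourhood of \<open>f\<close>
  is the finite intersection over all seminorms that enter \<open>schwartz_norm N\<close>.\<close>

lemma continuous_map_schwartz_subspace:
  fixes u :: "(real^'n::finite \<Rightarrow> complex) \<Rightarrow> complex"
  assumes V: "V \<subseteq> schwartz" and "\<And>f g. f \<in> V \<Longrightarrow> g \<in> V \<Longrightarrow> (\<lambda>x. f x - g x) \<in> V"
    and diff: "\<And>f g. f \<in> V \<Longrightarrow> g \<in> V \<Longrightarrow> u (\<lambda>x. f x - g x) = u f - u g"
    and bound: "\<And>h. h \<in> V \<Longrightarrow> norm (u h) \<le> C * schwartz_norm N h"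
  shows "continuous_map (subtopology schwartz_topology V) euclidean u"
proof -
  have "openin (subtopology schwartz_topology V) {x \<in> V. u x \<in> S}" if S: "open S" for S
  proof (subst openin_subopen, intro ballI)
    fix f assume "f \<in> {x \<in> V. u x \<in> S}"
    then have f: "f \<in> V" "u f \<in> S" by auto
    with S obtain e where e: "0 < e" "ball (u f) e \<subseteq> S" using open_contains_ball by blast
    define I where "I = {is :: 'n list. length is \<le> N} \<times> {\<alpha> :: 'n \<Rightarrow> nat. \<forall>i. \<alpha> i \<le> N}"
    have I: "finite I" "I \<noteq> {}"
      by (auto simp: I_def finite_lists_le finite_multi_indices_le intro!: exI[of _ "[]"] exI[of _ "\<lambda>_. 0"])
    \<comment> \<open>The \<open>card I\<close> seminorms below \<open>\<delta>\<close> must add up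
      to less than \<open>e\<close> after multiplication by \<open>C\<close>. The added ones keep
      the denominator positive and the final inequality strict.\<close>
    define \<delta> where "\<delta> = e / ((\<bar>C\<bar> + 1) * (card I + 1))"
    have \<delta>: "0 < \<delta>" using e by (auto simp: \<delta>_def intro!: divide_pos_pos mult_pos_pos add_nonneg_pos)
    define T where "T = (\<Inter>(is, \<alpha>)\<in>I. {g \<in> schwartz. schwartz_seminorm \<alpha> is (\<lambda>x. g x - f x) < \<delta>})"
    have "openin schwartz_topology T"
      unfolding T_def
    proof (intro openin_INT2 I, clarify)
      fix "is" \<alpha>
      show "openin schwartz_topology {g \<in> schwartz. schwartz_seminorm \<alpha> is (\<lambda>x. g x - f x) < \<delta>}"
        unfolding schwartz_topology_def using f(1) V \<delta> by (intro topology_generated_by_Basis) blast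
    qed
    then have "openin (subtopology schwartz_topology V) (T \<inter> V)"
      by (auto simp: openin_subtopology)
    moreover have "f \<in> T \<inter> V"
    proof -
      have "schwartz_seminorm \<alpha> is (\<lambda>x :: real^'n. 0) \<le> 0" for \<alpha> "is"
        using schwartz_cmult(2)[OF schwartz_zero, of \<alpha> "is" 0] by simp
      then show ?thesis using f V \<delta> by (auto simp: T_def intro: le_less_trans[OF _ \<delta>])
    qed
    moreover have "T \<inter> V \<subseteq> {x \<in> V. u x \<in> S}"
    proof
      fix g assume g: "g \<in> T \<inter> V"
      have d: "(\<lambda>x. g x - f x) \<in> V" using g f assms(2) by blast
      have "schwartz_norm N (\<lambda>x. g x - f x) = (\<Sum>(is, \<alpha>)\<in>I. schwartz_seminorm \<alpha> is (\<lambda>x. g x - f x))"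
        by (simp add: schwartz_norm_def I_def sum.cartesian_product)
      also have "\<dots> \<le> (\<Sum>_\<in>I. \<delta>)"
        using g by (intro sum_mono) (auto simp: T_def)
      finally have *: "schwartz_norm N (\<lambda>x. g x - f x) \<le> card I * \<delta>" by simp
      have "norm (u g - u f) \<le> C * schwartz_norm N (\<lambda>x. g x - f x)"
        using bound[OF d] diff[of g f] g f by simp
      also have "\<dots> \<le> \<bar>C\<bar> * (card I * \<delta>)"
        using * schwartz_norm_nonneg[of "\<lambda>x. g x - f x" N] d V by (intro mult_mono) auto
      also have "\<dots> < (\<bar>C\<bar> + 1) * ((card I + 1) * \<delta>)"
      proof (rule mult_strict_mono')
        show "card I * \<delta> < (card I + 1) * \<delta>" using \<delta> by (intro mult_strict_right_mono) auto
      qed (use \<delta> in auto)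
      also have "\<dots> = e" by (simp add: \<delta>_def add_nonneg_eq_0_iff)
      finally have "u g \<in> ball (u f) e" by (simp add: dist_norm norm_minus_commute)
      then show "g \<in> {x \<in> V. u x \<in> S}" using g e by auto
    qed
    ultimately show "\<exists>T. openin (subtopology schwartz_topology V) T \<and> f \<in> T \<and> T \<subseteq> {x \<in> V. u x \<in> S}"
      by blast
  qed
  moreover have "topspace (subtopology schwartz_topology V) = V"
    using V by (auto simp: topspace_schwartz)
  ultimately show ?thesis by (simp add: continuous_map_def)
qed

section \<open>Integrals of Schwartz functions\<close>

text \<open>Comparison with the product of the one-variable functions \<open>1 / (1 + x^2)\<close>,
  whose integral factorises. Each of the \<open>CARD('n)\<close> factors
  \<open>1 + (x \<bullet> b)^2\<close> is at most \<open>(1 + norm x)^2\<close>, hence the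
  exponent.\<close>

lemma integrable_schwartz_weight:
  "integrable lborel (\<lambda>x :: real^'n::finite. 1 / (1 + norm x) ^ (2 * CARD('n)))"
proof (rule integrableI_bounded)
  have int1: "integrable lborel (\<lambda>x :: real. 1 / (1 + x\<^sup>2))"
    using integrable_inverse_1_plus_square
    by (simp add: set_integrable_def einterval_def inverse_eq_divide)
  then have fin: "(\<integral>\<^sup>+x. ennreal (1 / (1 + x\<^sup>2)) \<partial>(lborel :: real measure)) < \<infinity>"
    by (simp add: integrable_iff_bounded)
  have "norm (1 / (1 + norm x) ^ (2 * CARD('n))) \<le> (\<Prod>b\<in>Basis. 1 / (1 + (x \<bullet> b)\<^sup>2))" for x :: "real^'n"
  proof -
    have "(\<Prod>b\<in>Basis. 1 + (x \<bullet> b)\<^sup>2) \<le> (\<Prod>b\<in>(Basis :: (real^'n) set). (1 + norm x)\<^sup>2)"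
    proof (intro prod_mono conjI)
      fix b :: "real^'n" assume "b \<in> Basis"
      then have "(x \<bullet> b)\<^sup>2 \<le> (norm x)\<^sup>2" using Basis_le_norm[of b x] by (simp add: abs_le_square_iff[symmetric])
      then show "1 + (x \<bullet> b)\<^sup>2 \<le> (1 + norm x)\<^sup>2" using norm_ge_zero[of x] unfolding power2_sum by (simp add: add_increasing2)
    qed simp
    also have "\<dots> = (1 + norm x) ^ (2 * CARD('n))" by (simp add: power_mult)
    finally have "1 / (1 + norm x) ^ (2 * CARD('n)) \<le> 1 / (\<Prod>b\<in>Basis. 1 + (x \<bullet> b)\<^sup>2)"
      by (intro divide_left_mono mult_pos_pos prod_pos) (auto intro!: add_pos_nonneg zero_less_power)
    then show ?thesis by (simp add: prod_dividef)
  qed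
  then have "(\<integral>\<^sup>+x. ennreal (norm (1 / (1 + norm x) ^ (2 * CARD('n)))) \<partial>(lborel :: (real^'n) measure))
      \<le> (\<integral>\<^sup>+x. ennreal (\<Prod>b\<in>Basis. 1 / (1 + (x \<bullet> b)\<^sup>2)) \<partial>(lborel :: (real^'n) measure))"
    by (intro nn_integral_mono ennreal_leI)
  also have "\<dots> = (\<integral>\<^sup>+x. (\<Prod>b\<in>Basis. ennreal (1 / (1 + (x \<bullet> b)\<^sup>2))) \<partial>(lborel :: (real^'n) measure))"
    by (intro nn_integral_cong prod_ennreal[symmetric]) simp
  also have "\<dots> = (\<Prod>b\<in>(Basis :: (real^'n) set). \<integral>\<^sup>+x. ennreal (1 / (1 + x\<^sup>2)) \<partial>lborel)"
    by (rule nn_integral_lborel_prod[where f="\<lambda>_ x. ennreal (1 / (1 + x\<^sup>2))"]) auto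
  also have "\<dots> < \<infinity>" using fin by (simp add: power_less_top_ennreal)
  finally show "(\<integral>\<^sup>+x. ennreal (norm (1 / (1 + norm x) ^ (2 * CARD('n)))) \<partial>(lborel :: (real^'n) measure)) < \<infinity>" .
qed simp

text \<open>Of the available decay, \<open>2 * CARD('n)\<close> powers are set aside as the
  integrable majorant.\<close>

lemma schwartz_weight_bound:
  "\<exists>C\<ge>0. \<forall>f\<in>schwartz. \<forall>x :: real^'n::finite. (1 + norm x) ^ N * norm (f x) \<le>
    C * schwartz_norm (N + 2 * CARD('n)) f * (1 / (1 + norm x) ^ (2 * CARD('n)))"
proof -
  define M where "M = 2 * CARD('n)"
  obtain C where C: "0 \<le> C" "\<And>f is (x :: real^'n). f \<in> schwartz \<Longrightarrow> length is \<le> N + M \<Longrightarrow>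
    (1 + norm x) ^ (N + M) * norm (partial_derivs is f x) \<le> C * schwartz_norm (N + M) f"
    by (rule schwartz_decay[of "N + M"]) (rule that)
  have "(1 + norm x) ^ N * norm (f x) \<le> C * schwartz_norm (N + M) f * (1 / (1 + norm x) ^ M)"
    if f: "f \<in> schwartz" for f and x :: "real^'n"
  proof -
    have "0 < (1 + norm x) ^ M" by (simp add: add_pos_nonneg)
    then show ?thesis
      using C(2)[OF f, of "[]" x] by (simp add: partial_derivs_simps power_add pos_le_divide_eq mult_ac)
  qed
  then show ?thesis using C(1) unfolding M_def by blast
qed

lemma schwartz_integrable:
  fixes f :: "real^'n::finite \<Rightarrow> complex"
  assumes f: "f \<in> schwartz"
  shows "integrable lborel (\<lambda>x. (1 + norm x) ^ N * norm (f x))"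
proof -
  obtain C where C: "\<And>x. (1 + norm x) ^ N * norm (f x) \<le>
      C * schwartz_norm (N + 2 * CARD('n)) f * (1 / (1 + norm x) ^ (2 * CARD('n)))"
    using schwartz_weight_bound[of N, where 'n='n] f by blast
  show ?thesis
  proof (rule Bochner_Integration.integrable_bound)
    show "integrable lborel (\<lambda>x :: real^'n. C * schwartz_norm (N + 2 * CARD('n)) f * (1 / (1 + norm x) ^ (2 * CARD('n))))"
      by (intro integrable_mult_right integrable_schwartz_weight)
    have "continuous_on UNIV f" using smooth_continuous[OF schwartz_smooth[OF f], of UNIV "[]"] by (simp add: partial_derivs_simps)
    then have "continuous_on UNIV (\<lambda>x. (1 + norm x) ^ N * norm (f x))" by (intro continuous_intros)
    then show "(\<lambda>x. (1 + norm x) ^ N * norm (f x)) \<in> borel_measurable lborel"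
      by (simp add: borel_measurable_continuous_onI)
    show "AE x in lborel. norm ((1 + norm x) ^ N * norm (f x)) \<le>
        norm (C * schwartz_norm (N + 2 * CARD('n)) f * (1 / (1 + norm x) ^ (2 * CARD('n))))"
    proof (rule AE_I2)
      show "norm ((1 + norm x) ^ N * norm (f x)) \<le>
        norm (C * schwartz_norm (N + 2 * CARD('n)) f * (1 / (1 + norm x) ^ (2 * CARD('n))))" for x
        unfolding real_norm_def
        by (rule order_trans[OF eq_refl[OF abs_of_nonneg] order_trans[OF C abs_ge_self]]) simp
    qed
  qed
qed

lemma schwartz_integral_bound:
  "\<exists>C\<ge>0. \<forall>f :: real^'n::finite \<Rightarrow> complex. f \<in> schwartz \<longrightarrow>
    (LINT x|lborel. (1 + norm x) ^ N * norm (f x)) \<le> C * schwartz_norm (N + 2 * CARD('n)) f"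
proof -
  define W where "W = (\<lambda>x :: real^'n. 1 / (1 + norm x) ^ (2 * CARD('n)))"
  have W: "integrable lborel W" unfolding W_def by (rule integrable_schwartz_weight)
  obtain C where C: "0 \<le> C" "\<forall>f\<in>schwartz. \<forall>x. (1 + norm x) ^ N * norm (f x) \<le> C * schwartz_norm (N + 2 * CARD('n)) f * W x"
    using schwartz_weight_bound[of N, where 'n='n] unfolding W_def by blast
  have "(LINT x|lborel. (1 + norm x) ^ N * norm (f x)) \<le> (C * (LINT x|lborel. W x)) * schwartz_norm (N + 2 * CARD('n)) f"
    if f: "f \<in> schwartz" for f :: "real^'n \<Rightarrow> complex"
  proof -
    have "(LINT x|lborel. (1 + norm x) ^ N * norm (f x)) \<le> (LINT x|lborel. C * schwartz_norm (N + 2 * CARD('n)) f * W x)"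
      using schwartz_integrable[OF f] W C(2) f by (intro integral_mono) auto
    then show ?thesis by (simp add: mult_ac)
  qed
  moreover have "0 \<le> C * (LINT x|lborel. W x)"
    using C(1) by (intro mult_nonneg_nonneg integral_nonneg_AE) (auto simp: W_def)
  ultimately show ?thesis by (intro exI[of _ "C * (LINT x|lborel. W x)"] conjI allI impI)
qed

lemma norm_le_of_vector_derivative_le:
  fixes f :: "real \<Rightarrow> 'b::real_normed_vector"
  assumes "convex S" "\<And>s. s \<in> S \<Longrightarrow> (f has_vector_derivative f' s) (at s within S)"
    and "\<And>s. s \<in> S \<Longrightarrow> norm (f' s) \<le> B" "a \<in> S" "b \<in> S"
  shows "norm (f b - f a) \<le> B * \<bar>b - a\<bar>"
proof -
  have "0 \<le> B" using assms(3,4) norm_ge_zero order_trans by blast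
  then have "onorm (\<lambda>h. h *\<^sub>R f' s) \<le> B" if "s \<in> S" for s
    using assms(3)[OF that] by (intro onorm_bound) (auto simp: mult.commute[of B] intro!: mult_left_mono)
  then show ?thesis
    using differentiable_bound[of S f "\<lambda>s h. h *\<^sub>R f' s" B b a] assms
    by (simp add: has_vector_derivative_def)
qed

text \<open>Dominated convergence along sequences for the remainder quotient \<open>q\<close>. The
  mean value inequality bounds the increment of \<open>F\<close> and the hypothesis bounds the
  linear term, each by \<open>w\<close> times the step, hence the majorant
  \<open>2 * w\<close>.\<close>

lemma has_vector_derivative_lebesgue_integral:
  fixes F :: "real \<Rightarrow> 'a \<Rightarrow> 'b::{banach, second_countable_topology}"
  assumes int: "\<And>s. integrable M (F s)"
    and deriv: "\<And>s x. x \<in> space M \<Longrightarrow> ((\<lambda>s. F s x) has_vector_derivative F' s x) (at s)"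
    and bound: "\<And>s x. x \<in> space M \<Longrightarrow> norm (F' s x) \<le> w x"
    and w: "integrable M w" and meas: "F' t \<in> borel_measurable M"
  shows "((\<lambda>s. LINT x|M. F s x) has_vector_derivative (LINT x|M. F' t x)) (at t)"
proof -
  have int': "integrable M (F' t)"
    by (rule Bochner_Integration.integrable_bound[OF w meas]) (auto intro!: AE_I2 order_trans[OF bound])
  define q where "q = (\<lambda>s x. ((F s x - F t x) - (s - t) *\<^sub>R F' t x) /\<^sub>R norm (s - t))"
  have "((\<lambda>s. ((LINT x|M. F s x) - (LINT x|M. F t x) - (s - t) *\<^sub>R (LINT x|M. F' t x)) /\<^sub>R norm (s - t)) \<longlongrightarrow> 0) (at t)"
    unfolding tendsto_at_iff_sequentially
  proof (intro allI impI)
    fix X :: "nat \<Rightarrow> real" assume X: "\<forall>i. X i \<in> UNIV - {t}" "X \<longlonglongrightarrow> t"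
    have "(\<lambda>i. LINT x|M. q (X i) x) \<longlonglongrightarrow> (LINT x|M. 0)"
    proof (rule integral_dominated_convergence[where w="\<lambda>x. 2 * w x"])
      show "integrable M (\<lambda>x. 2 * w x)" using w by simp
      show "q (X i) \<in> borel_measurable M" for i
        unfolding q_def using int int' by (intro borel_measurable_integrable) auto
      show "AE x in M. (\<lambda>i. q (X i) x) \<longlonglongrightarrow> 0"
      proof (rule AE_I2)
        fix x assume "x \<in> space M"
        then have "((\<lambda>s. q s x) \<longlongrightarrow> 0) (at t)"
          using deriv[of x t] by (simp add: has_vector_derivative_def has_derivative_at_within q_def)
        then show "(\<lambda>i. q (X i) x) \<longlonglongrightarrow> 0"
          using X unfolding tendsto_at_iff_sequentially comp_def by blast
      qed
      show "AE x in M. norm (q (X i) x) \<le> 2 * w x" for i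
      proof (rule AE_I2)
        fix x assume x: "x \<in> space M"
        have "norm (F (X i) x - F t x) \<le> w x * \<bar>X i - t\<bar>"
          using deriv[OF x] bound[OF x] by (intro norm_le_of_vector_derivative_le[of UNIV _ "\<lambda>s. F' s x"]) auto
        moreover have "norm ((X i - t) *\<^sub>R F' t x) \<le> w x * \<bar>X i - t\<bar>"
          using bound[OF x, of t] by (simp add: mult.commute mult_right_mono)
        ultimately have "norm ((F (X i) x - F t x) - (X i - t) *\<^sub>R F' t x) \<le> 2 * w x * \<bar>X i - t\<bar>"
          using norm_triangle_ineq4[of "F (X i) x - F t x" "(X i - t) *\<^sub>R F' t x"] by linarith
        moreover have "0 < \<bar>X i - t\<bar>" using X by auto
        moreover have "norm (z /\<^sub>R norm d) \<le> c" if "norm z \<le> c * \<bar>d\<bar>" "0 < \<bar>d\<bar>" for z :: 'b and c d :: real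
          using that by (simp add: divide_inverse[symmetric] mult.commute[of "inverse _"] pos_divide_le_eq)
        ultimately show "norm (q (X i) x) \<le> 2 * w x"
          unfolding q_def by blast
      qed
    qed simp
    moreover have "(LINT x|M. q s x) = ((LINT x|M. F s x) - (LINT x|M. F t x) - (s - t) *\<^sub>R (LINT x|M. F' t x)) /\<^sub>R norm (s - t)" for s
      unfolding q_def using int int' by simp
    ultimately show "((\<lambda>s. ((LINT x|M. F s x) - (LINT x|M. F t x) - (s - t) *\<^sub>R (LINT x|M. F' t x)) /\<^sub>R norm (s - t)) \<circ> X) \<longlonglongrightarrow> 0"
      by (simp add: comp_def)
  qed
  then show ?thesis
    by (simp add: has_vector_derivative_def has_derivative_at_within bounded_linear_scaleR_left)
qed

lemma borel_measurable_cnj [measurable (raw)]: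
  "f \<in> borel_measurable M \<Longrightarrow> (\<lambda>x. cnj (f x)) \<in> borel_measurable M"
  by (rule measurable_compose[of f M borel cnj]) (auto intro: borel_measurable_continuous_onI continuous_intros)

lemma schwartz_measurable:
  fixes f :: "real^'n::finite \<Rightarrow> complex"
  assumes "f \<in> schwartz"
  shows "f \<in> borel_measurable borel"
  using smooth_continuous[OF schwartz_smooth[OF assms], of UNIV "[]"]
  by (simp add: partial_derivs_simps borel_measurable_continuous_onI)

section \<open>Vanishing moments\<close>

text \<open>Smoothness is left out on purpose: in \<open>pairing_affine_bound\<close> this function
  is only multiplied by coordinates, and without derivatives no product rule is required.\<close>

definition moment_free :: "(real^'n::finite \<Rightarrow> complex) \<Rightarrow> bool"
  where "moment_free g \<longleftrightarrow> g \<in> borel_measurable borel \<and>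
    (\<forall>N. integrable lborel (\<lambda>x. (1 + norm x) ^ N * norm (g x))) \<and>
    (\<forall>\<alpha>. (LINT x|lborel. monomial \<alpha> x *\<^sub>R g x) = 0)"

lemma integrable_of_weight:
  fixes g :: "real^'n::finite \<Rightarrow> complex" and p :: "real^'n \<Rightarrow> complex"
  assumes [measurable]: "g \<in> borel_measurable borel" "p \<in> borel_measurable borel"
    and int: "integrable lborel (\<lambda>x. (1 + norm x) ^ N * norm (g x))"
    and bound: "\<And>x. norm (p x) \<le> c * ((1 + norm x) ^ N * norm (g x))"
  shows "integrable lborel p"
  by (rule Bochner_Integration.integrable_bound[of _ "\<lambda>x. c * ((1 + norm x) ^ N * norm (g x))"])
    (use int bound in \<open>auto intro!: AE_I2 order_trans[OF bound] simp del: norm_mult\<close>)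

lemma borel_measurable_monomial [measurable]: "monomial \<alpha> \<in> borel_measurable (borel :: (real^'n::finite) measure)"
  unfolding monomial_def[abs_def]
  by (intro borel_measurable_continuous_onI continuous_intros)

lemma integrable_monomial_scaleR:
  fixes g :: "real^'n::finite \<Rightarrow> complex"
  assumes [measurable]: "g \<in> borel_measurable borel"
    and int: "\<And>N. integrable lborel (\<lambda>x. (1 + norm x) ^ N * norm (g x))"
  shows "integrable lborel (\<lambda>x. monomial \<alpha> x *\<^sub>R g x)"
  using norm_monomial_le[of \<alpha>]
  by (intro integrable_of_weight[OF assms(1) _ int, where c=1]) (auto intro!: mult_right_mono)

lemma monomial_Suc: "monomial (\<alpha>(i := Suc (\<alpha> i))) x = x $ i * monomial \<alpha> x"
  unfolding monomial_def
  by (subst (1 2) prod.remove[of UNIV i]) (auto simp: mult_ac)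

lemma Z_spaceD:
  fixes f :: "real^'n::finite \<Rightarrow> complex"
  assumes "f \<in> Z_space" shows "f \<in> schwartz" "moment_free f"
proof -
  show f: "f \<in> schwartz" using assms by (simp add: Z_space_def)
  have "integrable lborel (\<lambda>x. (1 + norm x) ^ N * norm (f x))" for N
    by (rule schwartz_integrable[OF f])
  then show "moment_free f"
    using assms schwartz_measurable[OF f] by (simp add: moment_free_def Z_space_def)
qed

text \<open>A coordinate factor raises a multi-index by one, so the new moments are among the old
  ones; the price is one power of the weight.\<close>

lemma moment_free_component:
  fixes g :: "real^'n::finite \<Rightarrow> complex"
  assumes g: "moment_free g"
  shows "moment_free (\<lambda>x. (x $ i) *\<^sub>R g x)"
    and "(LINT x|lborel. (1 + norm x) ^ N * norm ((x $ i) *\<^sub>R g x)) \<le>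
      (LINT x|lborel. (1 + norm x) ^ Suc N * norm (g x))"
proof -
  have [measurable]: "g \<in> borel_measurable borel" using g by (simp add: moment_free_def)
  have int: "integrable lborel (\<lambda>x. (1 + norm x) ^ N * norm (g x))" for N using g by (simp add: moment_free_def)
  have le: "(1 + norm x) ^ N * norm ((x $ i) *\<^sub>R g x) \<le> (1 + norm x) ^ Suc N * norm (g x)" for N x
  proof -
    have "\<bar>x $ i\<bar> \<le> 1 + norm x" using component_le_norm_cart[of x i] by linarith
    then have "(1 + norm x) ^ N * (\<bar>x $ i\<bar> * norm (g x)) \<le> (1 + norm x) ^ N * ((1 + norm x) * norm (g x))"
      by (intro mult_left_mono mult_right_mono) auto
    then show ?thesis by (simp add: mult_ac)
  qed
  have int2: "integrable lborel (\<lambda>x. (1 + norm x) ^ N * norm ((x $ i) *\<^sub>R g x))" for N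
    by (rule Bochner_Integration.integrable_bound[OF int[of "Suc N"]])
      (use le in \<open>auto simp: abs_mult power_abs intro!: AE_I2\<close>)
  have "(LINT x|lborel. monomial \<alpha> x *\<^sub>R ((x $ i) *\<^sub>R g x)) = 0" for \<alpha>
  proof -
    have "(LINT x|lborel. monomial (\<alpha>(i := Suc (\<alpha> i))) x *\<^sub>R g x) = 0"
      using g by (simp add: moment_free_def del: fun_upd_apply)
    then show ?thesis by (simp add: monomial_Suc mult.commute)
  qed
  then show "moment_free (\<lambda>x. (x $ i) *\<^sub>R g x)"
    using int2 by (simp add: moment_free_def)
  show "(LINT x|lborel. (1 + norm x) ^ N * norm ((x $ i) *\<^sub>R g x)) \<le>
      (LINT x|lborel. (1 + norm x) ^ Suc N * norm (g x))"
    by (intro integral_mono int int2 le)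
qed

text \<open>Up to powers of \<open>- \<i>\<close>, moments are derivatives of the Fourier transform
  at the origin, and these vanish when the transform is zero on a ball around it.\<close>

lemma Z_spaceI_fourier:
  fixes f :: "real^'n::finite \<Rightarrow> complex"
  assumes f: "f \<in> schwartz" and \<rho>: "0 < \<rho>" and zero: "\<And>\<xi>. norm \<xi> < \<rho> \<Longrightarrow> fourier f \<xi> = 0"
  shows "f \<in> Z_space"
proof -
  note [measurable] = schwartz_measurable[OF f]
  have int: "integrable lborel (\<lambda>x. (1 + norm x) ^ N * norm (f x))" for N
    by (rule schwartz_integrable[OF f])
  define E where "E = (\<lambda>\<alpha> \<xi> x. complex_of_real (monomial \<alpha> x) * (exp (- \<i> * complex_of_real (x \<bullet> \<xi>)) * f x))"
  have [measurable]: "E \<alpha> \<xi> \<in> borel_measurable borel" for \<alpha> \<xi> unfolding E_def by measurable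
  have normE: "norm (E \<alpha> \<xi> x) = \<bar>monomial \<alpha> x\<bar> * norm (f x)" for \<alpha> \<xi> x
    by (simp add: E_def norm_mult)
  have intE: "integrable lborel (E \<alpha> \<xi>)" for \<alpha> \<xi>
    using norm_monomial_le[of \<alpha>]
    by (intro integrable_of_weight[OF schwartz_measurable[OF f] _ int, where c=1]) (auto simp: normE intro!: mult_right_mono)
  \<comment> \<open>Claimed on the whole ball and not only at the origin, since the induction on the
    degree differentiates in \<open>\<xi>\<close>.\<close>
  have "(LINT x|lborel. E \<alpha> \<xi> x) = 0" if "(\<Sum>i\<in>UNIV. \<alpha> i) = m" "norm \<xi> < \<rho>" for m \<alpha> \<xi>
    using that
  proof (induction m arbitrary: \<alpha> \<xi>)
    case 0
    then show ?case using zero[of \<xi>] by (simp add: E_def monomial_def fourier_def)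
  next
    case (Suc m)
    obtain i where i: "0 < \<alpha> i" using Suc.prems(1) by (metis nat.discI neq0_conv sum.neutral)
    define \<beta> where "\<beta> = \<alpha>(i := \<alpha> i - 1)"
    have \<alpha>: "\<alpha> = \<beta>(i := Suc (\<beta> i))" using i by (auto simp: \<beta>_def)
    have "(\<Sum>i\<in>UNIV. \<alpha> i) = Suc (\<Sum>i\<in>UNIV. \<beta> i)"
      unfolding \<alpha> by (subst (1 2) sum.remove[of UNIV i]) auto
    then have m: "(\<Sum>i\<in>UNIV. \<beta> i) = m" using Suc.prems(1) by simp
    have shift: "E \<beta> (\<xi> + s *\<^sub>R axis i 1) x =
        complex_of_real (monomial \<beta> x) * (exp (- \<i> * complex_of_real (x \<bullet> \<xi> + s * x $ i)) * f x)" for s x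
      by (simp add: E_def inner_right_distrib inner_axis)
    have "((\<lambda>s. LINT x|lborel. E \<beta> (\<xi> + s *\<^sub>R axis i 1) x) has_vector_derivative
        (LINT x|lborel. - \<i> * E \<alpha> (\<xi> + 0 *\<^sub>R axis i 1) x)) (at 0)"
    \<comment> \<open>The phase has modulus one, so this majorant serves every
      \<open>s\<close>.\<close>
    proof (rule has_vector_derivative_lebesgue_integral[where w="\<lambda>x. norm (E \<alpha> \<xi> x)"])
      show "integrable lborel (E \<beta> (\<xi> + s *\<^sub>R axis i 1))" for s by (rule intE)
      show "((\<lambda>s. E \<beta> (\<xi> + s *\<^sub>R axis i 1) x) has_vector_derivative - \<i> * E \<alpha> (\<xi> + s *\<^sub>R axis i 1) x) (at s)" for s x
      proof -
        \<comment> \<open>Differentiated in a complex variable first, then restricted to the real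
          line.\<close>
        have "((\<lambda>s. complex_of_real (monomial \<beta> x) * (exp (- \<i> * (complex_of_real (x \<bullet> \<xi>) + s * complex_of_real (x $ i))) * f x))
          has_field_derivative (complex_of_real (monomial \<beta> x) *
            (exp (- \<i> * (complex_of_real (x \<bullet> \<xi>) + complex_of_real s * complex_of_real (x $ i))) * (- \<i> * complex_of_real (x $ i)) * f x)))
          (at (complex_of_real s))"
          by (auto intro!: derivative_eq_intros simp: algebra_simps)
        from has_vector_derivative_real_field[OF this]
        have "((\<lambda>s. E \<beta> (\<xi> + s *\<^sub>R axis i 1) x) has_vector_derivative (complex_of_real (monomial \<beta> x) *
            (exp (- \<i> * (complex_of_real (x \<bullet> \<xi>) + complex_of_real s * complex_of_real (x $ i))) * (- \<i> * complex_of_real (x $ i)) * f x))) (at s)"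
          by (simp add: shift)
        moreover have "complex_of_real (monomial \<beta> x) *
            (exp (- \<i> * (complex_of_real (x \<bullet> \<xi>) + complex_of_real s * complex_of_real (x $ i))) * (- \<i> * complex_of_real (x $ i)) * f x)
          = - \<i> * E \<alpha> (\<xi> + s *\<^sub>R axis i 1) x"
          unfolding \<alpha> by (simp add: E_def monomial_Suc inner_right_distrib inner_axis)
        ultimately show ?thesis by (simp only:)
      qed
      show "norm (- \<i> * E \<alpha> (\<xi> + s *\<^sub>R axis i 1) x) \<le> norm (E \<alpha> \<xi> x)" for s x
        by (simp add: norm_mult normE)
      show "integrable lborel (\<lambda>x. norm (E \<alpha> \<xi> x))" using intE by (rule integrable_norm)
    qed measurable
    \<comment> \<open>For \<open>|s| < \<rho> - norm \<xi>\<close> the shifted frequency stays in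
      the ball, where the integral is zero by induction; uniqueness of the derivative then gives the
      next moment.\<close>
    moreover have "((\<lambda>s. LINT x|lborel. E \<beta> (\<xi> + s *\<^sub>R axis i 1) x) has_vector_derivative 0) (at 0)"
    proof (rule has_vector_derivative_transform_within_open[OF has_vector_derivative_const[of 0]])
      show "0 = (LINT x|lborel. E \<beta> (\<xi> + s *\<^sub>R axis i 1) x)" if "s \<in> {- (\<rho> - norm \<xi>)<..<\<rho> - norm \<xi>}" for s
      proof -
        have "norm (\<xi> + s *\<^sub>R axis i 1) < \<rho>"
          using norm_triangle_ineq[of \<xi> "s *\<^sub>R axis i 1"] that by (auto simp: norm_axis_1)
        then show ?thesis using Suc.IH[OF m] by simp
      qed
    qed (use Suc.prems in auto)
    ultimately have "(LINT x|lborel. - \<i> * E \<alpha> (\<xi> + 0 *\<^sub>R axis i 1) x) = 0"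
      by (rule vector_derivative_unique_at)
    then show ?case by simp
  qed
  from this[OF refl, of 0] \<rho> show ?thesis
    using f by (simp add: Z_space_def E_def scaleR_conv_of_real)
qed

lemma lborel_integral_affine:
  fixes f :: "'a::euclidean_space \<Rightarrow> 'b::{banach, second_countable_topology}"
  assumes [measurable]: "f \<in> borel_measurable borel" and r: "r \<noteq> 0"
  shows "(LINT x|lborel. f (r *\<^sub>R x + b)) = (1 / \<bar>r\<bar> ^ DIM('a)) *\<^sub>R (LINT x|lborel. f x)"
proof -
  have "(LINT x|lborel. f x) = (LINT x|density (distr lborel borel (\<lambda>x. b + r *\<^sub>R x)) (\<lambda>_. \<bar>r\<bar> ^ DIM('a)). f x)"
    using lborel_affine[OF r, of b] by simp
  also have "\<dots> = (LINT x|distr lborel borel (\<lambda>x. b + r *\<^sub>R x). (\<bar>r\<bar> ^ DIM('a)) *\<^sub>R f x)"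
    by (rule integral_density) auto
  also have "\<dots> = (LINT x|lborel. (\<bar>r\<bar> ^ DIM('a)) *\<^sub>R f (b + r *\<^sub>R x))"
    by (rule integral_distr) auto
  finally show ?thesis using r by (simp add: add.commute)
qed

text \<open>Translation gives a phase and dilation rescales the frequency, so a zero of the
  transform is carried from \<open>\<xi> / r\<close> to \<open>\<xi>\<close>.\<close>

lemma fourier_affine_eq_0:
  fixes f :: "real^'n::finite \<Rightarrow> complex"
  assumes f[measurable]: "f \<in> borel_measurable borel" and r: "0 < r" and z: "fourier f (\<xi> /\<^sub>R r) = 0"
  shows "fourier (\<lambda>x. c * f (r *\<^sub>R x + b)) \<xi> = 0"
proof -
  define H where "H = (\<lambda>y. exp (- \<i> * complex_of_real (y \<bullet> (\<xi> /\<^sub>R r))) * f y)"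
  have [measurable]: "H \<in> borel_measurable borel" unfolding H_def by measurable
  have "exp (- \<i> * complex_of_real (x \<bullet> \<xi>)) * (c * f (r *\<^sub>R x + b)) =
      (c * exp (\<i> * complex_of_real (b \<bullet> (\<xi> /\<^sub>R r)))) * H (r *\<^sub>R x + b)" for x
  proof -
    have diff_eq: "- \<i> * complex_of_real (p - q) = \<i> * complex_of_real q + - \<i> * complex_of_real p" for p q
      by (simp add: algebra_simps)
    have "x \<bullet> \<xi> = (r *\<^sub>R x + b) \<bullet> (\<xi> /\<^sub>R r) - b \<bullet> (\<xi> /\<^sub>R r)" using r by (simp add: inner_add_left field_simps)
    then have "- \<i> * complex_of_real (x \<bullet> \<xi>) =
        \<i> * complex_of_real (b \<bullet> (\<xi> /\<^sub>R r)) + - \<i> * complex_of_real ((r *\<^sub>R x + b) \<bullet> (\<xi> /\<^sub>R r))"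
      using diff_eq by metis
    then show ?thesis unfolding H_def by (simp only: exp_add mult_ac)
  qed
  then have "fourier (\<lambda>x. c * f (r *\<^sub>R x + b)) \<xi> =
      (c * exp (\<i> * complex_of_real (b \<bullet> (\<xi> /\<^sub>R r)))) * (LINT x|lborel. H (r *\<^sub>R x + b))"
    unfolding fourier_def by (metis (no_types, lifting) integral_mult_right_zero Bochner_Integration.integral_cong)
  also have "(LINT x|lborel. H (r *\<^sub>R x + b)) = 0"
    using r z by (subst lborel_integral_affine) (auto simp: H_def fourier_def)
  finally show ?thesis by simp
qed

section \<open>Almost orthogonality\<close>

text \<open>Every vanishing moment of \<open>g\<close> gains a factor \<open>t\<close>, since the
  \<open>t\<close>-derivative of the pairing is a sum of pairings of \<open>x\<^sub>i g\<close> with \<open>\<partial>\<^sub>i f\<close>, and the pairing vanishes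
  at \<open>t = 0\<close>.\<close>

lemma pairing_affine_bound:
  fixes f g :: "real^'n::finite \<Rightarrow> complex" and t :: real
  assumes "moment_free g" "smooth f"
    and "\<And>is x. length is \<le> L \<Longrightarrow> (1 + norm x) ^ N * norm (partial_derivs is f x) \<le> B"
    and "(LINT x|lborel. (1 + norm x) ^ (N + L) * norm (g x)) \<le> D"
    and "0 \<le> t" "t \<le> 1"
  shows "norm (LINT x|lborel. g x * cnj (f (t *\<^sub>R x + v))) * (1 + norm v) ^ N \<le> (CARD('n) * t) ^ L * (B * D)"
  using assms
proof (induction L arbitrary: g f t)
  case 0
  note g = \<open>moment_free g\<close>
  have [measurable]: "g \<in> borel_measurable borel" using g by (simp add: moment_free_def)
  have int: "integrable lborel (\<lambda>x. (1 + norm x) ^ N * norm (g x))" for N using g by (simp add: moment_free_def)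
  have fm[measurable]: "f \<in> borel_measurable borel"
    using smooth_continuous[OF \<open>smooth f\<close>, of UNIV "[]"] by (simp add: partial_derivs_simps borel_measurable_continuous_onI)
  have B: "(1 + norm x) ^ N * norm (f x) \<le> B" for x using "0.prems"(3)[of "[]"] by (simp add: partial_derivs_simps)
  have B0: "0 \<le> B" using order_trans[OF norm_ge_zero, of "f 0" B] B[of 0] by simp
  have le: "norm (g x * cnj (f (t *\<^sub>R x + v))) * (1 + norm v) ^ N \<le> B * ((1 + norm x) ^ N * norm (g x))" for x
  proof -
    \<comment> \<open>A Peetre-type inequality: since \<open>t \<le> 1\<close>, the weight in
      \<open>v\<close> splits into a weight at \<open>t x + v\<close>, absorbed by \<open>f\<close>,
      and a weight at \<open>x\<close>, absorbed by \<open>g\<close>.\<close>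
    have "norm v \<le> norm (t *\<^sub>R x + v) + norm (t *\<^sub>R x)"
      using norm_triangle_ineq4[of "t *\<^sub>R x + v" "t *\<^sub>R x"] by simp
    also have "norm (t *\<^sub>R x) \<le> norm x" using 0 by (simp add: mult_left_le_one_le)
    finally have "1 + norm v \<le> (1 + norm (t *\<^sub>R x + v)) * (1 + norm x)"
      using mult_nonneg_nonneg[OF norm_ge_zero norm_ge_zero, of "t *\<^sub>R x + v" x]
      unfolding distrib_left distrib_right by linarith
    then have "(1 + norm v) ^ N \<le> ((1 + norm (t *\<^sub>R x + v)) * (1 + norm x)) ^ N" by (intro power_mono) auto
    then have "norm (g x * cnj (f (t *\<^sub>R x + v))) * (1 + norm v) ^ N \<le>
        norm (g x * cnj (f (t *\<^sub>R x + v))) * ((1 + norm (t *\<^sub>R x + v)) * (1 + norm x)) ^ N"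
      by (intro mult_left_mono) auto
    also have "\<dots> = ((1 + norm (t *\<^sub>R x + v)) ^ N * norm (f (t *\<^sub>R x + v))) * ((1 + norm x) ^ N * norm (g x))"
      by (simp add: norm_mult power_mult_distrib mult_ac)
    also have "\<dots> \<le> B * ((1 + norm x) ^ N * norm (g x))" by (intro mult_right_mono B) auto
    finally show ?thesis .
  qed
  have "norm (LINT x|lborel. g x * cnj (f (t *\<^sub>R x + v))) * (1 + norm v) ^ N
     = norm ((LINT x|lborel. g x * cnj (f (t *\<^sub>R x + v))) * complex_of_real ((1 + norm v) ^ N))"
    by (simp only: norm_mult norm_of_real) simp
  also have "\<dots> = norm (LINT x|lborel. g x * cnj (f (t *\<^sub>R x + v)) * complex_of_real ((1 + norm v) ^ N))"
    by simp
  also have "\<dots> \<le> (LINT x|lborel. B * ((1 + norm x) ^ N * norm (g x)))"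
  proof (rule Bochner_Integration.integral_norm_bound_integral)
    have "norm (g x * cnj (f (t *\<^sub>R x + v)) * complex_of_real ((1 + norm v) ^ N)) =
        norm (g x * cnj (f (t *\<^sub>R x + v))) * (1 + norm v) ^ N" for x
      by (simp only: norm_mult norm_of_real) simp
    then show *: "norm (g x * cnj (f (t *\<^sub>R x + v)) * complex_of_real ((1 + norm v) ^ N)) \<le> B * ((1 + norm x) ^ N * norm (g x))" for x
      using le by simp
    show "integrable lborel (\<lambda>x. B * ((1 + norm x) ^ N * norm (g x)))" using int by simp
    show "integrable lborel (\<lambda>x. g x * cnj (f (t *\<^sub>R x + v)) * complex_of_real ((1 + norm v) ^ N))"
      by (rule integrable_of_weight[OF _ _ int *]) measurable
  qed
  also have "\<dots> = B * (LINT x|lborel. (1 + norm x) ^ N * norm (g x))" by simp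
  also have "\<dots> \<le> B * D" using "0.prems"(4) B0 by (intro mult_left_mono) auto
  finally show ?case by simp
next
  case (Suc L)
  note g = \<open>moment_free g\<close> and f = \<open>smooth f\<close>
  have gm[measurable]: "g \<in> borel_measurable borel" using g by (simp add: moment_free_def)
  have int: "integrable lborel (\<lambda>x. (1 + norm x) ^ N * norm (g x))" for N using g by (simp add: moment_free_def)
  have cont: "continuous_on UNIV (partial_derivs is f)" for "is" by (rule smooth_continuous[OF f])
  have meas: "(\<lambda>x. partial_derivs is f (s *\<^sub>R x + v)) \<in> borel_measurable borel" for "is" s
    by (intro borel_measurable_continuous_onI continuous_on_compose2[OF cont] continuous_intros) auto
  have B: "norm (partial_derivs is f x) \<le> B" if "length is \<le> Suc L" for "is" x
  proof -
    have "1 * norm (partial_derivs is f x) \<le> (1 + norm x) ^ N * norm (partial_derivs is f x)"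
      by (intro mult_right_mono one_le_power) auto
    then show ?thesis using Suc.prems(3)[OF that, of x] by simp
  qed
  have B0: "0 \<le> B" using order_trans[OF norm_ge_zero B[of "[]"]] by simp
  have D0: "0 \<le> D"
    using order_trans[OF integral_nonneg_AE Suc.prems(4)] by simp
  define G where "G = (\<lambda>s. LINT x|lborel. g x * cnj (f (s *\<^sub>R x + v)))"
  define G' where "G' = (\<lambda>s i. LINT x|lborel. (x $ i) *\<^sub>R g x * cnj (partial_deriv i f (s *\<^sub>R x + v)))"
  have intg: "integrable lborel (\<lambda>x. g x * cnj (f (s *\<^sub>R x + v)))" for s
  proof (rule integrable_of_weight[OF gm _ int[of 0], of _ B])
    show "(\<lambda>x. g x * cnj (f (s *\<^sub>R x + v))) \<in> borel_measurable borel"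
      using meas[of "[]" s] by (simp add: partial_derivs_simps)
    show "norm (g x * cnj (f (s *\<^sub>R x + v))) \<le> B * ((1 + norm x) ^ 0 * norm (g x))" for x
      using mult_right_mono[OF B[of "[]" "s *\<^sub>R x + v"], of "norm (g x)"]
      by (simp add: partial_derivs_simps norm_mult mult.commute)
  qed
  have intg': "integrable lborel (\<lambda>x. (x $ i) *\<^sub>R g x * cnj (partial_deriv i f (s *\<^sub>R x + v)))" for s i
  proof (rule integrable_of_weight[OF gm _ int[of 1], of _ B])
    show "(\<lambda>x. (x $ i) *\<^sub>R g x * cnj (partial_deriv i f (s *\<^sub>R x + v))) \<in> borel_measurable borel"
      using meas[of "[i]" s] by (simp add: partial_derivs_simps)
    fix x :: "real^'n"
    have "\<bar>x $ i\<bar> \<le> 1 + norm x" using component_le_norm_cart[of x i] by linarith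
    then have "\<bar>x $ i\<bar> * norm (g x) * norm (partial_deriv i f (s *\<^sub>R x + v)) \<le> (1 + norm x) * norm (g x) * B"
      using B[of "[i]"] by (intro mult_mono) (auto simp: partial_derivs_simps)
    then show "norm ((x $ i) *\<^sub>R g x * cnj (partial_deriv i f (s *\<^sub>R x + v))) \<le> B * ((1 + norm x) ^ 1 * norm (g x))"
      by (simp add: norm_mult mult_ac)
  qed
  have G_deriv: "(G has_vector_derivative (\<Sum>i\<in>UNIV. G' s i)) (at s)" for s
  proof -
    have "(G has_vector_derivative (LINT x|lborel. (\<Sum>i\<in>UNIV. (x $ i) *\<^sub>R g x * cnj (partial_deriv i f (s *\<^sub>R x + v))))) (at s)"
      unfolding G_def
    proof (rule has_vector_derivative_lebesgue_integral[where w="\<lambda>x. (CARD('n) * B) * ((1 + norm x) ^ 1 * norm (g x))"])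
      show "integrable lborel (\<lambda>x. g x * cnj (f (s *\<^sub>R x + v)))" for s by (rule intg)
      fix s x
      have "((\<lambda>s. f (s *\<^sub>R x + v)) has_vector_derivative (\<Sum>i\<in>UNIV. (x $ i) *\<^sub>R partial_deriv i f (s *\<^sub>R x + v))) (at s)"
      proof -
        have "((\<lambda>s. f (s *\<^sub>R x + v)) has_derivative (\<lambda>h. \<Sum>i\<in>UNIV. (h *\<^sub>R x) $ i *\<^sub>R partial_deriv i f (s *\<^sub>R x + v))) (at s)"
          by (rule has_derivative_compose[OF _ has_derivative_partial_derivs[OF f, of "[]", unfolded partial_derivs_simps]])
            (auto intro!: derivative_eq_intros)
        then show ?thesis by (simp add: has_vector_derivative_def scaleR_sum_right)
      qed
      from has_vector_derivative_cnj[OF this]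
      have "((\<lambda>s. g x * cnj (f (s *\<^sub>R x + v))) has_vector_derivative
          g x * cnj (\<Sum>i\<in>UNIV. (x $ i) *\<^sub>R partial_deriv i f (s *\<^sub>R x + v))) (at s)"
        by (rule has_vector_derivative_mult_right)
      then show "((\<lambda>s. g x * cnj (f (s *\<^sub>R x + v))) has_vector_derivative
          (\<Sum>i\<in>UNIV. (x $ i) *\<^sub>R g x * cnj (partial_deriv i f (s *\<^sub>R x + v)))) (at s)"
        by (simp add: sum_distrib_left scaleR_conv_of_real mult_ac)
      have "norm (\<Sum>i\<in>UNIV. (x $ i) *\<^sub>R g x * cnj (partial_deriv i f (s *\<^sub>R x + v)))
          \<le> (\<Sum>i\<in>(UNIV :: 'n set). (1 + norm x) * norm (g x) * B)"
      proof (rule order_trans[OF norm_sum sum_mono])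
        fix i
        have "\<bar>x $ i\<bar> \<le> 1 + norm x" using component_le_norm_cart[of x i] by linarith
        then have "\<bar>x $ i\<bar> * norm (g x) * norm (partial_deriv i f (s *\<^sub>R x + v)) \<le> (1 + norm x) * norm (g x) * B"
          using B[of "[i]"] by (intro mult_mono) (auto simp: partial_derivs_simps)
        then show "norm ((x $ i) *\<^sub>R g x * cnj (partial_deriv i f (s *\<^sub>R x + v))) \<le> (1 + norm x) * norm (g x) * B"
          by (simp add: norm_mult)
      qed
      then show "norm (\<Sum>i\<in>UNIV. (x $ i) *\<^sub>R g x * cnj (partial_deriv i f (s *\<^sub>R x + v)))
          \<le> (CARD('n) * B) * ((1 + norm x) ^ 1 * norm (g x))"
        by (simp add: mult_ac)
    next
      show "integrable lborel (\<lambda>x. (CARD('n) * B) * ((1 + norm x) ^ 1 * norm (g x)))"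
        by (intro integrable_mult_right int)
      show "(\<lambda>x. \<Sum>i\<in>UNIV. (x $ i) *\<^sub>R g x * cnj (partial_deriv i f (s *\<^sub>R x + v))) \<in> borel_measurable lborel"
        by (intro borel_measurable_sum borel_measurable_integrable intg')
    qed
    then show ?thesis using intg' by (simp add: G'_def)
  qed
  \<comment> \<open>The bound of the induction hypothesis at the endpoint \<open>t\<close>, divided
    by the weight in \<open>v\<close>. It is increasing in the parameter and so covers all
    \<open>s\<close> between 0 and \<open>t\<close>.\<close>
  define A where "A = (CARD('n) * t) ^ L * (B * D) / (1 + norm v) ^ N"
  have v: "0 < (1 + norm v) ^ N" by (simp add: add_pos_nonneg)
  have G'_bound: "norm (G' s i) \<le> A" if s: "0 \<le> s" "s \<le> t" for s i
  proof -
    have "norm (G' s i) * (1 + norm v) ^ N \<le> (CARD('n) * s) ^ L * (B * D)"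
      unfolding G'_def
    proof (rule Suc.IH)
      show "moment_free (\<lambda>x. (x $ i) *\<^sub>R g x)" by (rule moment_free_component[OF g])
      show "smooth (partial_deriv i f)" using smooth_partial_derivs[OF f, of "[i]"] by (simp add: partial_derivs_simps)
      show "(1 + norm x) ^ N * norm (partial_derivs is (partial_deriv i f) x) \<le> B" if "length is \<le> L" for "is" x
        using Suc.prems(3)[of "is @ [i]" x] that by (simp add: partial_derivs_simps)
      \<comment> \<open>The coordinate factor uses up one power of the weight, which is why the
        assumed exponent on \<open>g\<close> grows with the number of moments.\<close>
      show "(LINT x|lborel. (1 + norm x) ^ (N + L) * norm ((x $ i) *\<^sub>R g x)) \<le> D"
        using moment_free_component(2)[OF g, of "N + L" i] Suc.prems(4) by simp
    qed (use s Suc.prems in auto)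
    also have "\<dots> \<le> (CARD('n) * t) ^ L * (B * D)"
      using s B0 D0 by (intro mult_right_mono power_mono mult_left_mono) auto
    finally show ?thesis using v by (simp add: A_def pos_le_divide_eq)
  qed
  have "norm (G t - G 0) \<le> (CARD('n) * A) * \<bar>t - 0\<bar>"
  proof (rule norm_le_of_vector_derivative_le[of "{0..t}" _ "\<lambda>s. \<Sum>i\<in>UNIV. G' s i"])
    show "(G has_vector_derivative (\<Sum>i\<in>UNIV. G' s i)) (at s within {0..t})" for s
      using G_deriv by (rule has_vector_derivative_at_within)
    show "norm (\<Sum>i\<in>UNIV. G' s i) \<le> CARD('n) * A" if "s \<in> {0..t}" for s
      using order_trans[OF norm_sum sum_mono[of UNIV "\<lambda>i. norm (G' s i)" "\<lambda>_. A"]] G'_bound that by simp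
  qed (use Suc.prems in auto)
  \<comment> \<open>At parameter 0 the second factor is the constant \<open>cnj (f v)\<close>,
    leaving the moment of order zero.\<close>
  moreover have "G 0 = 0"
  proof -
    have "(LINT x|lborel. g x) = 0"
      using g unfolding moment_free_def by (auto dest!: spec[of _ "\<lambda>_. 0 :: nat"] simp: monomial_def)
    then show ?thesis by (simp add: G_def)
  qed
  ultimately have "norm (G t) \<le> (CARD('n) * t) * A" using Suc.prems(5) by (simp add: mult_ac)
  then have "norm (G t) * (1 + norm v) ^ N \<le> (CARD('n) * t) * A * (1 + norm v) ^ N"
    using v by (intro mult_right_mono) auto
  also have "\<dots> = (CARD('n) * t) ^ Suc L * (B * D)"
    using less_imp_neq[OF v] by (simp add: A_def del: power_eq_0_iff)
  finally show ?case unfolding G_def .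
qed

section \<open>Summation over dyadic cubes\<close>

abbreviation int_vec :: "int^'n \<Rightarrow> real^'n::finite"
  where "int_vec k \<equiv> \<chi> i. of_int (k $ i)"

lemma summable_on_int_abs:
  fixes g :: "nat \<Rightarrow> real"
  assumes "summable g" "\<And>n. 0 \<le> g n"
  shows "(\<lambda>\<nu> :: int. g (nat \<bar>\<nu>\<bar>)) summable_on UNIV"
proof -
  have "(\<lambda>\<nu>. g (nat \<bar>\<nu>\<bar>)) summable_on range int"
    using summable_nonneg_imp_summable_on[OF assms] by (subst summable_on_reindex) (auto simp: comp_def)
  \<comment> \<open>Starting at \<open>Suc n\<close> keeps 0 from being counted twice.\<close>
  moreover have "(\<lambda>\<nu>. g (nat \<bar>\<nu>\<bar>)) summable_on range (\<lambda>n. - int (Suc n))"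
    using summable_nonneg_imp_summable_on[of "\<lambda>n. g (Suc n)"] assms
    by (subst summable_on_reindex) (auto simp: comp_def inj_on_def summable_Suc_iff nat_add_distrib)
  moreover have "range int \<union> range (\<lambda>n. - int (Suc n)) = UNIV"
  proof (intro equalityI subsetI)
    show "z \<in> range int \<union> range (\<lambda>n. - int (Suc n))" for z
      by (cases z rule: int_cases) (auto simp del: of_nat_Suc)
  qed simp
  moreover have "range int \<inter> range (\<lambda>n. - int (Suc n)) = {}" by auto
  ultimately show ?thesis using summable_on_Un_disjoint by metis
qed

text \<open>A finite set of vectors lies in a finite box, and over a box the sum of products
  factorises.\<close>

lemma summable_on_int_vec_prod:
  fixes g :: "int \<Rightarrow> real"
  assumes g: "g summable_on UNIV" and nonneg: "\<And>j. 0 \<le> g j"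
  shows "(\<lambda>k :: int^'n::finite. \<Prod>i\<in>UNIV. g (k $ i)) summable_on UNIV"
proof (rule nonneg_bdd_above_summable_on)
  show "bdd_above (sum (\<lambda>k :: int^'n. \<Prod>i\<in>UNIV. g (k $ i)) ` {F. F \<subseteq> UNIV \<and> finite F})"
  proof (rule bdd_aboveI2)
    fix F :: "(int^'n) set" assume "F \<in> {F. F \<subseteq> UNIV \<and> finite F}"
    then have F: "finite F" by simp
    define A where "A = (\<Union>i. (\<lambda>k. k $ i) ` F)"
    have A: "finite A" using F by (simp add: A_def)
    have inj: "inj_on vec_nth F" by (auto simp: inj_on_def vec_nth_inject)
    have "(\<Sum>k\<in>F. \<Prod>i\<in>UNIV. g (k $ i)) = (\<Sum>p\<in>vec_nth ` F. \<Prod>i\<in>UNIV. g (p i))"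
      by (simp add: sum.reindex[OF inj] comp_def)
    also have "\<dots> \<le> (\<Sum>p\<in>PiE (UNIV :: 'n set) (\<lambda>_. A). \<Prod>i\<in>UNIV. g (p i))"
      using A nonneg by (intro sum_mono2 finite_PiE) (auto simp: A_def intro!: prod_nonneg)
    also have "\<dots> = (\<Prod>i\<in>(UNIV :: 'n set). \<Sum>j\<in>A. g j)"
      using A by (intro prod_sum_PiE[symmetric]) auto
    also have "\<dots> \<le> (\<Prod>i\<in>(UNIV :: 'n set). infsum g UNIV)"
      using A g nonneg by (intro prod_mono conjI sum_nonneg finite_sum_le_infsum) auto
    finally show "(\<Sum>k\<in>F. \<Prod>i\<in>UNIV. g (k $ i)) \<le> (\<Prod>i\<in>(UNIV :: 'n set). infsum g UNIV)" .
  qed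
qed (use nonneg in \<open>auto intro!: prod_nonneg\<close>)

text \<open>The summable reference family: what remains of the decay of the pairings with
  \<open>\<psi>\<close> once the growth of the coefficients has been cancelled.\<close>

definition cube_weight :: "int \<Rightarrow> int^'n::finite \<Rightarrow> real"
  where "cube_weight \<nu> k = (1 / 2) ^ nat \<bar>\<nu>\<bar> / (1 + norm (int_vec k)) ^ (2 * CARD('n))"

lemma cube_weight_nonneg: "0 \<le> cube_weight \<nu> k"
  by (simp add: cube_weight_def)

text \<open>A geometric series in \<open>\<nu>\<close>; in \<open>k\<close>, the discrete form of
  the comparison in \<open>integrable_schwartz_weight\<close>.\<close>

lemma summable_on_cube_weight: "(\<lambda>(\<nu>, k :: int^'n::finite). cube_weight \<nu> k) summable_on UNIV"
proof -
  define g where "g = (\<lambda>n. 1 / (1 + (real n)\<^sup>2))"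
  have "summable g"
  proof (rule summable_comparison_test_ev)
    show "summable (\<lambda>n. inverse (real n ^ 2))" by (intro inverse_power_summable) simp
    show "\<forall>\<^sub>F n in sequentially. norm (g n) \<le> inverse (real n ^ 2)"
      using eventually_gt_at_top[of 0]
      by eventually_elim (auto simp: g_def divide_simps add_pos_nonneg)
  qed
  then have "(\<lambda>j :: int. g (nat \<bar>j\<bar>)) summable_on UNIV"
    by (rule summable_on_int_abs) (simp add: g_def)
  then have prod: "(\<lambda>k :: int^'n. \<Prod>i\<in>UNIV. g (nat \<bar>k $ i\<bar>)) summable_on UNIV"
    by (rule summable_on_int_vec_prod) (simp add: g_def)
  have le: "1 / (1 + norm (int_vec k)) ^ (2 * CARD('n)) \<le> (\<Prod>i\<in>UNIV. g (nat \<bar>k $ i\<bar>))" for k :: "int^'n"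
  proof -
    have "(\<Prod>i\<in>UNIV. 1 + (real_of_int (k $ i))\<^sup>2) \<le> (\<Prod>i\<in>(UNIV :: 'n set). (1 + norm (int_vec k))\<^sup>2)"
    proof (intro prod_mono conjI)
      fix i
      have "(real_of_int (k $ i))\<^sup>2 \<le> (norm (int_vec k))\<^sup>2"
        using component_le_norm_cart[of "int_vec k" i] by (simp add: abs_le_square_iff[symmetric])
      then show "1 + (real_of_int (k $ i))\<^sup>2 \<le> (1 + norm (int_vec k))\<^sup>2"
        using norm_ge_zero[of "int_vec k"] unfolding power2_sum by (simp add: add_increasing2)
    qed simp
    also have "\<dots> = (1 + norm (int_vec k)) ^ (2 * CARD('n))" by (simp add: power_mult)
    finally have "1 / (1 + norm (int_vec k)) ^ (2 * CARD('n)) \<le> 1 / (\<Prod>i\<in>UNIV. 1 + (real_of_int (k $ i))\<^sup>2)"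
      by (intro divide_left_mono mult_pos_pos prod_pos) (auto intro!: add_pos_nonneg zero_less_power)
    then show ?thesis by (simp add: g_def prod_dividef)
  qed
  have vec: "(\<lambda>k :: int^'n. 1 / (1 + norm (int_vec k)) ^ (2 * CARD('n))) summable_on UNIV"
    by (rule summable_on_comparison_test[OF prod]) (use le in auto)
  have "(\<lambda>\<nu> :: int. (1 / 2 :: real) ^ nat \<bar>\<nu>\<bar>) summable_on UNIV"
    by (rule summable_on_int_abs) (auto intro: summable_geometric)
  then have "(\<lambda>\<nu> :: int. (1 / 2) ^ nat \<bar>\<nu>\<bar> * (\<Sum>\<^sub>\<infinity>k::int^'n. 1 / (1 + norm (int_vec k)) ^ (2 * CARD('n)))) summable_on UNIV"
    by (rule summable_on_cmult_left)
  then have "(\<lambda>(\<nu>, k :: int^'n). cube_weight \<nu> k) summable_on (UNIV \<times> UNIV)"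
  proof (rule summable_on_SigmaI[rotated])
    fix \<nu> :: int
    show "((\<lambda>k :: int^'n. case (\<nu>, k) of (\<nu>, k) \<Rightarrow> cube_weight \<nu> k) has_sum
        ((1 / 2) ^ nat \<bar>\<nu>\<bar> * (\<Sum>\<^sub>\<infinity>k::int^'n. 1 / (1 + norm (int_vec k)) ^ (2 * CARD('n))))) UNIV"
      using has_sum_cmult_right[OF has_sum_infsum[OF vec], of "(1 / 2) ^ nat \<bar>\<nu>\<bar>"]
      by (simp add: cube_weight_def)
  qed (auto simp: cube_weight_nonneg)
  then show ?thesis by simp
qed

section \<open>Dilates as affine substitutions, and the bounds on pairing with them\<close>

lemma dilate_eq: "dilate f \<nu> k =
    (\<lambda>x. complex_of_real (2 powr (real CARD('n) * of_int \<nu> / 2)) * f (2 powi \<nu> *\<^sub>R x + (- int_vec k)))"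
  for f :: "real^'n::finite \<Rightarrow> complex"
  by (simp add: dilate_def fun_eq_iff)

lemma integrable_schwartz_mult:
  fixes f g :: "real^'n::finite \<Rightarrow> complex"
  assumes f: "f \<in> schwartz" and g: "g \<in> schwartz"
  shows "integrable lborel (\<lambda>x. f x * cnj (g x))"
proof -
  note [measurable] = schwartz_measurable[OF f] schwartz_measurable[OF g]
  have int: "integrable lborel (\<lambda>x. (1 + norm x) ^ N * norm (f x))" for N
    by (rule schwartz_integrable[OF f])
  have "norm (g x) \<le> schwartz_seminorm (\<lambda>_. 0) [] g" for x
    using norm_le_schwartz_seminorm[OF g, of "\<lambda>_. 0" x "[]"] by (simp add: monomial_def partial_derivs_simps)
  then show ?thesis
    by (intro integrable_of_weight[OF schwartz_measurable[OF f] _ int[of 0], of _ "schwartz_seminorm (\<lambda>_. 0) [] g"])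
      (auto simp: norm_mult mult.commute[of _ "norm (f _)"] intro!: mult_left_mono)
qed

lemma Z_space_add: "f \<in> Z_space \<Longrightarrow> g \<in> Z_space \<Longrightarrow> (\<lambda>x. f x + g x) \<in> Z_space"
  for f g :: "real^'n::finite \<Rightarrow> complex"
  using Z_spaceD[of f] Z_spaceD[of g] integrable_monomial_scaleR[of f] integrable_monomial_scaleR[of g]
  by (simp add: Z_space_def schwartz_add scaleR_add_right moment_free_def)

lemma Z_space_cmult: "f \<in> Z_space \<Longrightarrow> (\<lambda>x. c * f x) \<in> Z_space" for f :: "real^'n::finite \<Rightarrow> complex"
proof -
  assume f: "f \<in> Z_space"
  have "(LINT x|lborel. monomial \<alpha> x *\<^sub>R (c * f x)) = c * (LINT x|lborel. monomial \<alpha> x *\<^sub>R f x)" for \<alpha>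
    by (simp flip: integral_mult_right_zero add: scaleR_conv_of_real mult_ac)
  with f show "(\<lambda>x. c * f x) \<in> Z_space" by (simp add: Z_space_def schwartz_cmult)
qed

lemma Z_space_diff: "f \<in> Z_space \<Longrightarrow> g \<in> Z_space \<Longrightarrow> (\<lambda>x. f x - g x) \<in> Z_space"
  for f g :: "real^'n::finite \<Rightarrow> complex"
  using Z_space_add[of f "\<lambda>x. -1 * g x"] Z_space_cmult[of g "-1"] by simp

text \<open>The transform of \<open>\<phi>\<close> vanishes for \<open>norm \<xi> < Kl0\<close>,
  hence that of the dilate vanishes on the ball of radius \<open>2^\<nu> * Kl0\<close>.\<close>

lemma admissible_dilate_Z_space:
  fixes \<phi> :: "real^'n::finite \<Rightarrow> complex"
  assumes "admissible_constants Kl0 Kl1 Ku1 Ku0" "admissible Kl0 Kl1 Ku1 Ku0 \<phi>"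
  shows "dilate \<phi> \<nu> k \<in> Z_space" "\<phi> \<in> Z_space"
proof -
  have K: "0 < Kl0" using assms by (simp add: admissible_constants_def)
  have \<phi>: "\<phi> \<in> schwartz" using assms by (simp add: admissible_def)
  have zero: "fourier \<phi> \<xi> = 0" if "norm \<xi> < Kl0" for \<xi>
    using assms(2) closure_subset[of "{\<xi>. fourier \<phi> \<xi> \<noteq> 0}"] that by (fastforce simp: admissible_def)
  show "\<phi> \<in> Z_space" by (rule Z_spaceI_fourier[OF \<phi> K zero])
  have r: "0 < (2 :: real) powi \<nu>" by simp
  show "dilate \<phi> \<nu> k \<in> Z_space"
    unfolding dilate_eq
  proof (rule Z_spaceI_fourier[OF schwartz_affine[OF \<phi> r] mult_pos_pos[OF r K]])
    fix \<xi> :: "real^'n" assume "norm \<xi> < 2 powi \<nu> * Kl0"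
    then have "fourier \<phi> (\<xi> /\<^sub>R 2 powi \<nu>) = 0"
      using r by (intro zero) (simp add: divide_inverse[symmetric] mult.commute[of "inverse _"] pos_divide_less_eq mult.commute)
    then show "fourier (\<lambda>x. complex_of_real (2 powr (real CARD('n) * of_int \<nu> / 2)) *
        \<phi> (2 powi \<nu> *\<^sub>R x + - int_vec k)) \<xi> = 0"
      by (rule fourier_affine_eq_0[OF schwartz_measurable[OF \<phi>] r])
  qed
qed

text \<open>In each scale regime the less concentrated of the two functions is nearly constant where
  the other lives, so the moments of the more concentrated one are used. The bound
  \<open>key\<close> holds for any two members of \<Z>, and the regimes use it with the roles
  exchanged.\<close>

lemma fun_pairing_dilate_bound:
  fixes \<psi> :: "real^'n::finite \<Rightarrow> complex"
  assumes \<psi>: "\<psi> \<in> Z_space"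
  shows "\<exists>C K. 0 \<le> C \<and> (\<forall>h\<in>Z_space. \<forall>\<nu> k. norm (fun_pairing (dilate \<psi> \<nu> k) h) \<le>
    C * schwartz_norm K h * ((1 / 2) ^ (N * nat \<bar>\<nu>\<bar>) / (1 + norm (int_vec k)) ^ N))"
proof -
  \<comment> \<open>Of the \<open>2 * N\<close> powers of \<open>t\<close> gained from moments,
    \<open>N\<close> remain as decay in the scale; for \<open>\<nu> \<ge> 0\<close> the other
    \<open>N\<close> compensate for the translation by \<open>t k\<close>.\<close>
  define L where "L = 2 * N"
  define K where "K = N + L + 2 * CARD('n)"
  obtain C1 where C1: "0 \<le> C1" "\<And>f is (x :: real^'n). f \<in> schwartz \<Longrightarrow> length is \<le> N + L \<Longrightarrow>
    (1 + norm x) ^ (N + L) * norm (partial_derivs is f x) \<le> C1 * schwartz_norm (N + L) f"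
    by (rule schwartz_decay[of "N + L"]) (rule that)
  obtain C2 where C2: "0 \<le> C2" "\<And>f :: real^'n \<Rightarrow> complex. f \<in> schwartz \<Longrightarrow>
      (LINT x|lborel. (1 + norm x) ^ (N + L) * norm (f x)) \<le> C2 * schwartz_norm K f"
    using schwartz_integral_bound[of "N + L", where 'n='n] unfolding K_def by blast
  have key: "norm (LINT x|lborel. g x * cnj (f (t *\<^sub>R x + v))) * (1 + norm v) ^ N \<le>
      (real CARD('n) * t) ^ L * ((C1 * schwartz_norm K f) * (C2 * schwartz_norm K g))"
    if f: "f \<in> Z_space" and g: "g \<in> Z_space" and t: "0 \<le> t" "t \<le> 1"
    for f g :: "real^'n \<Rightarrow> complex" and t and v :: "real^'n"
  proof (rule pairing_affine_bound[OF Z_spaceD(2)[OF g] schwartz_smooth[OF Z_spaceD(1)[OF f]] _ C2(2)[OF Z_spaceD(1)[OF g]] t])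
    fix "is" :: "'n list" and x :: "real^'n" assume l: "length is \<le> L"
    have "(1 + norm x) ^ N * norm (partial_derivs is f x) \<le> (1 + norm x) ^ (N + L) * norm (partial_derivs is f x)"
      by (intro mult_right_mono power_increasing) auto
    also have "\<dots> \<le> C1 * schwartz_norm (N + L) f"
      using l by (intro C1 Z_spaceD f) auto
    also have "\<dots> \<le> C1 * schwartz_norm K f"
      by (intro mult_left_mono schwartz_norm_mono Z_spaceD f C1(1)) (simp add: K_def)
    finally show "(1 + norm x) ^ N * norm (partial_derivs is f x) \<le> C1 * schwartz_norm K f" .
  qed
  define C where "C = real CARD('n) ^ L * (C1 * C2 * schwartz_norm K \<psi>)"
  have C0: "0 \<le> C" using C1(1) C2(1) schwartz_norm_nonneg[OF Z_spaceD(1)[OF \<psi>]] by (simp add: C_def)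
  have "norm (fun_pairing (dilate \<psi> \<nu> k) h) \<le>
    C * schwartz_norm K h * ((1 / 2) ^ (N * nat \<bar>\<nu>\<bar>) / (1 + norm (int_vec k)) ^ N)"
    if h: "h \<in> Z_space" for h \<nu> k
  proof -
    define c where "c = 2 powr (real CARD('n) * of_int \<nu> / 2)"
    define t where "t = (1 / 2 :: real) ^ nat \<bar>\<nu>\<bar>"
    define P where "P = C * schwartz_norm K h"
    have P0: "0 \<le> P" using C0 schwartz_norm_nonneg[OF Z_spaceD(1)[OF h]] by (simp add: P_def)
    have t: "0 < t" "t \<le> 1" by (auto simp: t_def power_le_one)
    have c0: "0 \<le> c" by (simp add: c_def)
    have tN: "(1 / 2) ^ (N * nat \<bar>\<nu>\<bar>) = t ^ N" by (simp add: t_def power_mult[symmetric] mult.commute)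
    have kpos: "0 < (1 + norm (int_vec k)) ^ N" by (simp add: add_pos_nonneg)
    have key1: "norm (LINT x|lborel. h x * cnj (\<psi> (t *\<^sub>R x + v))) * (1 + norm v) ^ N \<le> t ^ L * P"
      and key2: "norm (LINT x|lborel. \<psi> x * cnj (h (t *\<^sub>R x + v))) * (1 + norm v) ^ N \<le> t ^ L * P" for v
      using key[OF \<psi> h, of t v] key[OF h \<psi>, of t v] t by (simp_all add: P_def C_def power_mult_distrib mult_ac)
    have "norm (fun_pairing (dilate \<psi> \<nu> k) h) * (1 + norm (int_vec k)) ^ N \<le> P * t ^ N"
    \<comment> \<open>For negative \<open>\<nu>\<close> the dilate is the wide function: it has
      scale \<open>t\<close> already, the translation is \<open>-k\<close>, and the normalising
      factor \<open>c\<close> is at most 1.\<close>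
    proof (cases "\<nu> < 0")
      case True
      have two: "2 powi \<nu> = t" using True by (simp add: t_def power_int_def power_one_over inverse_eq_divide)
      have "c \<le> 2 powr 0" unfolding c_def using True by (intro powr_mono) (auto simp: mult_nonneg_nonpos)
      then have c1: "c \<le> 1" by simp
      have "fun_pairing (dilate \<psi> \<nu> k) h =
          (LINT x|lborel. complex_of_real c * cnj (h x * cnj (\<psi> (t *\<^sub>R x + - int_vec k))))"
        unfolding fun_pairing_def dilate_eq two c_def[symmetric]
        by (intro Bochner_Integration.integral_cong refl) (simp add: mult_ac)
      then have "fun_pairing (dilate \<psi> \<nu> k) h = c * cnj (LINT x|lborel. h x * cnj (\<psi> (t *\<^sub>R x + - int_vec k)))"
        by (simp only: integral_mult_right_zero Bochner_Integration.integral_cnj)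
      then have "norm (fun_pairing (dilate \<psi> \<nu> k) h) \<le> 1 * norm (LINT x|lborel. h x * cnj (\<psi> (t *\<^sub>R x + - int_vec k)))"
        using c0 c1 by (simp only: norm_mult complex_mod_cnj norm_of_real abs_of_nonneg mult_right_mono norm_ge_zero)
      then have "norm (fun_pairing (dilate \<psi> \<nu> k) h) * (1 + norm (int_vec k)) ^ N \<le>
          norm (LINT x|lborel. h x * cnj (\<psi> (t *\<^sub>R x + - int_vec k))) * (1 + norm (- int_vec k)) ^ N"
        using kpos by (simp only: norm_minus_cancel mult_1_left mult_right_mono less_imp_le)
      also have "\<dots> \<le> t ^ L * P" by (rule key1)
      also have "\<dots> \<le> t ^ N * P" using t P0 by (intro mult_right_mono power_decreasing) (auto simp: L_def)
      finally show ?thesis by (simp add: mult.commute)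
    next
      case False
      have two: "2 powi \<nu> = 1 / t" using False by (simp add: t_def power_int_def power_one_over)
      define I where "I = (LINT x|lborel. \<psi> x * cnj (h (t *\<^sub>R x + t *\<^sub>R int_vec k)))"
      define H where "H = (\<lambda>y. \<psi> y * cnj (h (t *\<^sub>R y + t *\<^sub>R int_vec k)))"
      have [measurable]: "\<psi> \<in> borel_measurable borel" "h \<in> borel_measurable borel"
        using \<psi> h Z_spaceD schwartz_measurable by blast+
      have H[measurable]: "H \<in> borel_measurable borel" unfolding H_def by measurable
      \<comment> \<open>Substituting \<open>x = t y + t k\<close> moves the dilation and the
        translation from \<open>\<psi>\<close> onto \<open>h\<close>, with Jacobian
        \<open>t ^ CARD('n)\<close>.\<close>
      have "fun_pairing (dilate \<psi> \<nu> k) h = c * (LINT x|lborel. H ((1 / t) *\<^sub>R x + - int_vec k))"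
        using t by (simp add: fun_pairing_def dilate_eq two c_def H_def algebra_simps flip: integral_mult_right_zero)
      also have "(LINT x|lborel. H ((1 / t) *\<^sub>R x + - int_vec k)) = (t ^ CARD('n)) *\<^sub>R I"
        using t by (subst lborel_integral_affine[OF H]) (auto simp: I_def H_def power_one_over)
      finally have "norm (fun_pairing (dilate \<psi> \<nu> k) h) = (c * t ^ CARD('n)) * norm I"
        using t c0 by (simp add: norm_mult)
      \<comment> \<open>With \<open>n = CARD('n)\<close> the Jacobian is
        \<open>2^(-n \<nu>)\<close>, which outweighs the normalisation
        \<open>c = 2^(n \<nu> / 2)\<close>.\<close>
      moreover have "c * t ^ CARD('n) \<le> 1"
      proof -
        have "c \<le> 2 powr (real CARD('n) * of_int \<nu>)"
          unfolding c_def using False by (intro powr_mono) auto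
        also have "\<dots> = 2 powr real (CARD('n) * nat \<bar>\<nu>\<bar>)" using False by simp
        also have "\<dots> = 2 ^ (CARD('n) * nat \<bar>\<nu>\<bar>)" by (rule powr_realpow) simp
        also have "\<dots> = 1 / t ^ CARD('n)" by (simp add: t_def power_one_over power_mult[symmetric] mult.commute)
        finally show ?thesis using t by (simp add: pos_le_divide_eq)
      qed
      ultimately have I1: "norm (fun_pairing (dilate \<psi> \<nu> k) h) \<le> norm I"
        using mult_right_mono[of "c * t ^ CARD('n)" 1 "norm I"] by simp
      \<comment> \<open>The loss of \<open>t ^ N\<close> in passing from the weight at
        \<open>t k\<close> to the weight at \<open>k\<close>; it is cancelled against half of
        \<open>t ^ L\<close>.\<close>
      have "t * (1 + norm (int_vec k)) \<le> 1 + norm (t *\<^sub>R int_vec k)" using t by (simp add: distrib_left)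
      then have "t ^ N * (1 + norm (int_vec k)) ^ N \<le> (1 + norm (t *\<^sub>R int_vec k)) ^ N"
        unfolding power_mult_distrib[symmetric] using t by (intro power_mono) auto
      then have "norm I * (t ^ N * (1 + norm (int_vec k)) ^ N) \<le> norm I * (1 + norm (t *\<^sub>R int_vec k)) ^ N"
        by (intro mult_left_mono) auto
      also have "\<dots> \<le> t ^ L * P" unfolding I_def by (rule key2)
      also have "\<dots> = t ^ N * (P * t ^ N)" by (simp add: L_def mult_2 power_add)
      finally have "t ^ N * (norm I * (1 + norm (int_vec k)) ^ N) \<le> t ^ N * (P * t ^ N)" by (simp only: mult_ac)
      then have "norm I * (1 + norm (int_vec k)) ^ N \<le> P * t ^ N"
        using t by (simp only: mult_le_cancel_left_pos zero_less_power)
      with mult_right_mono[OF I1 less_imp_le[OF kpos]] show ?thesis by (rule order_trans)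
    qed
    then show ?thesis using kpos by (simp add: tN P_def pos_le_divide_eq)
  qed
  then show ?thesis using C0 by blast
qed

text \<open>With \<open>m = |\<nu>|\<close>, both \<open>1 + r\<close> and \<open>1 + 1 / r\<close>
  are at most \<open>2 * 2 ^ m\<close>, so fine and coarse scales are treated together.\<close>

lemma functional_dilate_bound:
  fixes \<phi> :: "real^'n::finite \<Rightarrow> complex" and u :: "(real^'n \<Rightarrow> complex) \<Rightarrow> complex"
  assumes \<phi>: "\<phi> \<in> schwartz" and B: "0 \<le> B"
    and u: "\<And>h. h \<in> schwartz \<Longrightarrow> norm (u h) \<le> B * schwartz_norm N h"
  shows "\<exists>C M. 0 \<le> C \<and> (\<forall>\<nu> k. norm (u (dilate \<phi> \<nu> k)) \<le> C * (2 ^ (M * nat \<bar>\<nu>\<bar>) * (1 + norm (int_vec k)) ^ M))"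
proof -
  obtain C L where C: "0 \<le> C" "\<And>r b c. 0 < r \<Longrightarrow> schwartz_norm N (\<lambda>x. c * \<phi> (r *\<^sub>R x + b))
     \<le> C * (norm c * ((1 + 1 / r) * (1 + norm b)) ^ L * (1 + r) ^ L)"
    by (rule schwartz_norm_affine[OF \<phi>, of N]) (rule that)
  \<comment> \<open>\<open>CARD('n)\<close> pays for the normalising factor, and \<open>L\<close>
    each for the powers of \<open>1 + r\<close> and of \<open>1 + 1 / r\<close>. Their constants
    \<open>2 ^ L\<close> combine to the \<open>4 ^ L\<close> below.\<close>
  define M where "M = CARD('n) + 2 * L"
  have "norm (u (dilate \<phi> \<nu> k)) \<le> (B * C * 4 ^ L) * (2 ^ (M * nat \<bar>\<nu>\<bar>) * (1 + norm (int_vec k)) ^ M)" for \<nu> k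
  proof -
    define r where "r = (2 :: real) powi \<nu>"
    define c where "c = 2 powr (real CARD('n) * of_int \<nu> / 2)"
    define m where "m = nat \<bar>\<nu>\<bar>"
    have r: "0 < r" by (simp add: r_def)
    have "r = 2 ^ m \<or> r = 1 / 2 ^ m" by (simp add: r_def m_def power_int_def inverse_eq_divide power_one_over)
    moreover from this have "1 / r = 1 / 2 ^ m \<or> 1 / r = 2 ^ m" by auto
    moreover have "1 \<le> (2 :: real) ^ m" "1 / 2 ^ m \<le> (1 :: real)" by simp_all
    ultimately have rm: "1 + r \<le> 2 * 2 ^ m" "1 + 1 / r \<le> 2 * 2 ^ m" by linarith+
    have "c \<le> 2 powr real (CARD('n) * m)"
    proof -
      have "real CARD('n) * of_int \<nu> / 2 \<le> real CARD('n) * (\<bar>of_int \<nu>\<bar>)"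
        using mult_left_mono[of "of_int \<nu> / 2" "\<bar>of_int \<nu>\<bar>" "real CARD('n)"] by auto
      then show ?thesis unfolding c_def m_def by (intro powr_mono) auto
    qed
    then have cm: "c \<le> 2 ^ (CARD('n) * m)" by (simp only: powr_realpow[of 2, simplified])
    have "norm (u (dilate \<phi> \<nu> k)) \<le> B * schwartz_norm N (dilate \<phi> \<nu> k)"
      unfolding dilate_eq by (intro u schwartz_affine \<phi>) simp
    also have "\<dots> \<le> B * (C * (norm (complex_of_real c) * ((1 + 1 / r) * (1 + norm (- int_vec k))) ^ L * (1 + r) ^ L))"
      unfolding dilate_eq c_def r_def by (intro mult_left_mono C(2) B) simp
    also have "\<dots> \<le> B * (C * (2 ^ (CARD('n) * m) * ((2 * 2 ^ m) * (1 + norm (int_vec k))) ^ L * (2 * 2 ^ m) ^ L))"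
      using B C(1) r rm cm
      by (intro mult_left_mono mult_mono power_mono mult_nonneg_nonneg zero_le_power) (auto simp: c_def)
    also have "\<dots> = (B * C * 4 ^ L) * (2 ^ (M * m) * (1 + norm (int_vec k)) ^ L)"
    proof -
      have "M * m = CARD('n) * m + (m * L + m * L)" by (simp add: M_def algebra_simps)
      then have e1: "(2 :: real) ^ (M * m) = 2 ^ (CARD('n) * m) * ((2 ^ m) ^ L * (2 ^ m) ^ L)"
        by (simp only: power_add power_mult)
      have e2: "(4 :: real) ^ L = 2 ^ L * 2 ^ L" by (simp flip: power_mult_distrib)
      show ?thesis unfolding e1 e2 power_mult_distrib by (simp only: mult_ac)
    qed
    also have "\<dots> \<le> (B * C * 4 ^ L) * (2 ^ (M * m) * (1 + norm (int_vec k)) ^ M)"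
      using B C(1) by (intro mult_left_mono power_increasing mult_nonneg_nonneg) (auto simp: M_def)
    finally show ?thesis by (simp add: m_def)
  qed
  then show ?thesis using B C(1) by (intro exI[of _ "B * C * 4 ^ L"] exI[of _ M]) simp
qed

section \<open>Distributions modulo polynomials\<close>

lemma fun_pairing_polynomial_Z_space:
  fixes p :: "real^'n::finite \<Rightarrow> complex"
  assumes p: "p \<in> polynomials" and h: "h \<in> Z_space"
  shows "fun_pairing p h = 0"
proof -
  obtain A c where A: "finite A" "p = (\<lambda>x. \<Sum>\<alpha>\<in>A. c \<alpha> * complex_of_real (monomial \<alpha> x))"
    using p by (auto simp: polynomials_def)
  have int: "integrable lborel (\<lambda>x. monomial \<alpha> x *\<^sub>R h x)" and zero: "(LINT x|lborel. monomial \<alpha> x *\<^sub>R h x) = 0" for \<alpha>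
    using Z_spaceD[OF h] integrable_monomial_scaleR[of h] by (auto simp: moment_free_def)
  have "fun_pairing p h = (LINT x|lborel. (\<Sum>\<alpha>\<in>A. c \<alpha> * cnj (monomial \<alpha> x *\<^sub>R h x)))"
    by (simp add: fun_pairing_def A(2) sum_distrib_right scaleR_conv_of_real mult.assoc)
  also have "\<dots> = (\<Sum>\<alpha>\<in>A. c \<alpha> * cnj (LINT x|lborel. monomial \<alpha> x *\<^sub>R h x))"
    using int by (subst Bochner_Integration.integral_sum) (auto intro!: integrable_mult_right simp: integrable_cnj simp del: complex_cnj_scaleR)
  finally show ?thesis by (simp add: zero)
qed

text \<open>Representatives differ by a polynomial, which pairs to zero with \<Z>, so the definite
  description has a value there; \<open>u\<close> belongs to its own class through the zero
  polynomial.\<close>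

lemma class_pairing_representative:
  assumes "F \<in> tempered_mod_polynomials"
  obtains u where "u \<in> tempered_distributions" "\<And>h. h \<in> Z_space \<Longrightarrow> class_pairing F h = u h"
proof -
  obtain u where u: "u \<in> tempered_distributions" "F = mod_polynomials `` {u}"
    using assms by (auto simp: tempered_mod_polynomials_def quotient_def)
  have "(\<lambda>x. 0) \<in> polynomials" unfolding polynomials_def by (intro CollectI exI[of _ "{}"]) auto
  then have uF: "u \<in> F"
    using u by (auto simp: mod_polynomials_def fun_pairing_def intro!: bexI[of _ "\<lambda>x. 0"])
  have "class_pairing F h = u h" if h: "h \<in> Z_space" for h
  proof -
    have "v h = u h" if "v \<in> F" for v
      using that h Z_spaceD(1)[OF h] fun_pairing_polynomial_Z_space[OF _ h]
      by (auto simp: u(2) mod_polynomials_def)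
    then show ?thesis
      unfolding class_pairing_def by (intro the_equality ballI) (use uF in metis)+
  qed
  then show ?thesis using that u(1) by blast
qed

text \<open>The decay order exceeds the growth order by \<open>2 * CARD('n)\<close>, exactly the
  power of \<open>1 + norm (int_vec k)\<close> in \<open>cube_weight\<close>; in the scale it leaves
  more than the required factor \<open>1 / 2\<close> per step.\<close>

lemma norm_mult_le_cube_weight:
  fixes k :: "int^'n::finite"
  assumes a: "norm a \<le> A * (2 ^ (M * nat \<bar>\<nu>\<bar>) * (1 + norm (int_vec k)) ^ M)"
    and b: "norm b \<le> B * ((1 / 2) ^ ((M + 2 * CARD('n)) * nat \<bar>\<nu>\<bar>) / (1 + norm (int_vec k)) ^ (M + 2 * CARD('n)))"
    and "0 \<le> A" "0 \<le> B"
  shows "norm (a * b :: complex) \<le> (A * B) * cube_weight \<nu> k"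
proof -
  define m where "m = nat \<bar>\<nu>\<bar>"
  define y where "y = 1 + norm (int_vec k)"
  have y: "0 < y" by (simp add: y_def add_pos_nonneg)
  have "norm (a * b) \<le> (A * (2 ^ (M * m) * y ^ M)) *
      (B * ((1 / 2) ^ ((M + 2 * CARD('n)) * m) / y ^ (M + 2 * CARD('n))))"
    unfolding norm_mult using assms y by (intro mult_mono) (auto simp: m_def y_def)
  also have "\<dots> = (A * B) * ((1 / 2) ^ (2 * CARD('n) * m) / y ^ (2 * CARD('n)))"
    using y by (simp add: add_mult_distrib power_add power_one_over)
  also have "\<dots> \<le> (A * B) * ((1 / 2) ^ m / y ^ (2 * CARD('n)))"
    using assms(3,4) y by (intro mult_left_mono divide_right_mono power_decreasing) auto
  finally show ?thesis by (simp add: cube_weight_def m_def y_def)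
qed

section \<open>Convergence and continuity of the sum over all cubes\<close>

theorem proposition3p3:
  fixes \<phi> \<psi> :: "real^'n::finite \<Rightarrow> complex"
    and F :: "((real^'n \<Rightarrow> complex) \<Rightarrow> complex) set"
  assumes "admissible_constants Kl0 Kl1 Ku1 Ku0"
    and "admissible Kl0 Kl1 Ku1 Ku0 \<phi>"
    and "admissible Kl0 Kl1 Ku1 Ku0 \<psi>"
    and "F \<in> tempered_mod_polynomials"
  shows "S_op \<phi> F \<in> T_domain \<psi> \<and>
         T_op \<psi> (S_op \<phi> F) \<in> Z_dual \<and>
         (\<forall>h\<in>Z_space.
           integrable (count_space dyadic_cubes)
             (\<lambda>Q. S_op \<phi> F Q * fun_pairing (on_cube \<psi> Q) h) \<and>
           T_op \<psi> (S_op \<phi> F) h =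
             (\<Sum>\<^sub>\<infinity>\<nu>::int. \<Sum>\<^sub>\<infinity>k::int^'n.
                S_op \<phi> F (dyadic_cube \<nu> k) * fun_pairing (on_cube \<psi> (dyadic_cube \<nu> k)) h))"
proof -
  define a where "a = S_op \<phi> F"
  define T where "T = (\<lambda>h Q. a Q * fun_pairing (on_cube \<psi> Q) h)"
  \<comment> \<open>This bijection transfers sums over cubes to sums over pairs, where
    \<open>cube_weight\<close> is known to be summable.\<close>
  define cube :: "int \<times> (int^'n) \<Rightarrow> (real^'n) set" where "cube = (\<lambda>(\<nu>, k). dyadic_cube \<nu> k)"
  have bij: "bij_betw cube UNIV dyadic_cubes"
    using inj_dyadic_cube[where 'n='n] by (auto simp: bij_betw_def cube_def dyadic_cubes_def image_iff)
  note \<phi>Z = admissible_dilate_Z_space[OF assms(1,2)] and \<psi>Z = admissible_dilate_Z_space[OF assms(1,3)]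
  obtain u where u: "u \<in> tempered_distributions" "\<And>h. h \<in> Z_space \<Longrightarrow> class_pairing F h = u h"
    using class_pairing_representative[OF assms(4)] by blast
  have a_cube: "a (dyadic_cube \<nu> k) = u (dilate \<phi> \<nu> k)" for \<nu> k
  proof -
    have "dyadic_cube \<nu> k \<in> dyadic_cubes" by (auto simp: dyadic_cubes_def)
    then show ?thesis by (simp add: a_def S_op_def on_cube_dyadic_cube u(2) \<phi>Z)
  qed
  obtain B N where B: "0 \<le> B" "\<And>h. h \<in> schwartz \<Longrightarrow> norm (u h) \<le> B * schwartz_norm N h"
    by (rule tempered_distribution_bound[OF u(1)]) (rule that)
  obtain C1 M where C1: "0 \<le> C1"
    "\<And>\<nu> k. norm (u (dilate \<phi> \<nu> k)) \<le> C1 * (2 ^ (M * nat \<bar>\<nu>\<bar>) * (1 + norm (int_vec k)) ^ M)"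
    using functional_dilate_bound[OF Z_spaceD(1)[OF \<phi>Z(2)] B(1), of u N] B(2) by blast
  \<comment> \<open>The decay order is fixed only here, because \<open>M\<close> depends on the
    class \<open>F\<close>.\<close>
  obtain C2 K where C2: "0 \<le> C2" "\<And>h \<nu> k. h \<in> Z_space \<Longrightarrow> norm (fun_pairing (dilate \<psi> \<nu> k) h) \<le>
    C2 * schwartz_norm K h * ((1 / 2) ^ ((M + 2 * CARD('n)) * nat \<bar>\<nu>\<bar>) / (1 + norm (int_vec k)) ^ (M + 2 * CARD('n)))"
    using fun_pairing_dilate_bound[OF \<psi>Z(2), of "M + 2 * CARD('n)"] by blast
  define W where "W = (\<lambda>p :: int \<times> (int^'n). case p of (\<nu>, k) \<Rightarrow> cube_weight \<nu> k)"
  have W: "W summable_on UNIV" unfolding W_def by (rule summable_on_cube_weight)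
  \<comment> \<open>The constant is linear in \<open>schwartz_norm K h\<close> and free of the cube,
    so this bound gives both summability and the continuity estimate \<open>U_le\<close>.\<close>
  have T_le: "norm (T h (cube p)) \<le> (C1 * (C2 * schwartz_norm K h)) * W p" if h: "h \<in> Z_space" for h p
  proof -
    obtain \<nu> k where p: "p = (\<nu>, k)" by (cases p)
    have "norm (u (dilate \<phi> \<nu> k) * fun_pairing (dilate \<psi> \<nu> k) h) \<le> (C1 * (C2 * schwartz_norm K h)) * cube_weight \<nu> k"
      using C1(1) C2(1) schwartz_norm_nonneg[OF Z_spaceD(1)[OF h]]
      by (intro norm_mult_le_cube_weight[OF C1(2) C2(2)[OF h]]) auto
    then show ?thesis by (simp add: T_def cube_def W_def p a_cube on_cube_dyadic_cube)
  qed
  have T_cube: "(\<lambda>p. norm (T h (cube p))) summable_on UNIV" if h: "h \<in> Z_space" for h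
    by (rule Infinite_Sum.abs_summable_on_comparison_test'[OF summable_on_cmult_right[OF W]]) (rule T_le[OF h])
  have T_abs: "(\<lambda>Q. norm (T h Q)) summable_on dyadic_cubes" if h: "h \<in> Z_space" for h
    using T_cube[OF h] summable_on_reindex_bij_betw[OF bij, of "\<lambda>Q. norm (T h Q)"] by simp
  then have T_sum: "T h summable_on dyadic_cubes" if "h \<in> Z_space" for h
    using that Infinite_Sum.abs_summable_summable by blast
  have infsum_cube: "infsum (T h) dyadic_cubes = (\<Sum>\<^sub>\<infinity>p. T h (cube p))" for h
    using infsum_reindex_bij_betw[OF bij, of "T h"] by simp
  \<comment> \<open>Restricted to \<Z> because members of \<open>Z_dual\<close> are extensional;
    this also makes the functional unique in the description of \<open>T_op\<close>.\<close>
  define U where "U = restrict (\<lambda>h. infsum (T h) dyadic_cubes) Z_space"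
  have pairing_Z: "on_cube \<psi> Q \<in> schwartz" if "Q \<in> dyadic_cubes" for Q
    using that by (auto simp: dyadic_cubes_def on_cube_dyadic_cube intro: Z_spaceD(1)[OF \<psi>Z(1)])
  have T_add: "T (\<lambda>x. f x + g x) Q = T f Q + T g Q" if "f \<in> Z_space" "g \<in> Z_space" "Q \<in> dyadic_cubes" for f g Q
    using integrable_schwartz_mult[OF pairing_Z Z_spaceD(1), of Q f] integrable_schwartz_mult[OF pairing_Z Z_spaceD(1), of Q g] that
    by (simp add: T_def fun_pairing_def distrib_left)
  have T_cmult: "T (\<lambda>x. c * f x) = (\<lambda>Q. cnj c * T f Q)" for c f
    by (rule ext) (simp add: T_def fun_pairing_def mult.left_commute[of _ "cnj c"])
  have U_add: "U (\<lambda>x. f x + g x) = U f + U g" if "f \<in> Z_space" "g \<in> Z_space" for f g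
  proof -
    have "infsum (T (\<lambda>x. f x + g x)) dyadic_cubes = (\<Sum>\<^sub>\<infinity>Q\<in>dyadic_cubes. T f Q + T g Q)"
      using that by (intro infsum_cong T_add)
    then show ?thesis using that by (simp add: U_def Z_space_add infsum_add T_sum)
  qed
  have U_cmult: "U (\<lambda>x. c * f x) = cnj c * U f" if "f \<in> Z_space" for c f
    using that by (simp add: U_def Z_space_cmult T_cmult infsum_cmult_right')
  have U_le: "norm (U h) \<le> (C1 * C2 * infsum W UNIV) * schwartz_norm K h" if h: "h \<in> Z_space" for h
  proof -
    have "norm (U h) \<le> (\<Sum>\<^sub>\<infinity>p. norm (T h (cube p)))"
      using h norm_infsum_bound[OF T_cube[OF h]] by (simp add: U_def infsum_cube)
    also have "\<dots> \<le> (\<Sum>\<^sub>\<infinity>p. (C1 * (C2 * schwartz_norm K h)) * W p)"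
      by (intro infsum_mono T_cube[OF h] summable_on_cmult_right W T_le h)
    finally show ?thesis unfolding infsum_cmult_right' by (simp only: mult_ac)
  qed
  have "continuous_map (subtopology schwartz_topology Z_space) euclidean U"
  proof (rule continuous_map_schwartz_subspace[OF _ Z_space_diff _ U_le])
    show "U (\<lambda>x. f x - g x) = U f - U g" if "f \<in> Z_space" "g \<in> Z_space" for f g
      using U_add[OF that(1) Z_space_cmult[OF that(2), of "-1"]] U_cmult[OF that(2), of "-1"] by simp
  qed (auto dest: Z_spaceD)
  then have U_dual: "U \<in> Z_dual"
    using U_add U_cmult by (auto simp: Z_dual_def antilinear_on_def U_def)
  have "T_op \<psi> a = U"
    unfolding T_op_def
  proof (rule the_equality)
    show "U \<in> Z_dual \<and> (\<forall>h\<in>Z_space. U h = (\<Sum>\<^sub>\<infinity>Q\<in>dyadic_cubes. a Q * fun_pairing (on_cube \<psi> Q) h))"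
      using U_dual by (simp add: U_def T_def)
    fix v assume v: "v \<in> Z_dual \<and> (\<forall>h\<in>Z_space. v h = (\<Sum>\<^sub>\<infinity>Q\<in>dyadic_cubes. a Q * fun_pairing (on_cube \<psi> Q) h))"
    show "v = U"
    proof (rule extensionalityI[of v Z_space])
      show "v \<in> extensional Z_space" using v by (simp add: Z_dual_def)
      show "v h = U h" if "h \<in> Z_space" for h using v that by (simp add: U_def T_def)
    qed (simp add: U_def)
  qed
  moreover have "a \<in> T_domain \<psi>"
    using T_abs by (auto simp: T_domain_def T_def norm_mult a_def S_op_def)
  moreover have "integrable (count_space dyadic_cubes) (T h)" if "h \<in> Z_space" for h
    \<comment> \<open>Bochner integrability for counting measure is absolute summability.\<close>
    using T_abs[OF that] unfolding abs_summable_equivalent abs_summable_on_def .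
  moreover have "U h = (\<Sum>\<^sub>\<infinity>\<nu>. \<Sum>\<^sub>\<infinity>k. T h (dyadic_cube \<nu> k))" if h: "h \<in> Z_space" for h
  proof -
    have "(\<lambda>p. T h (cube p)) summable_on UNIV \<times> UNIV"
      using Infinite_Sum.abs_summable_summable[OF T_cube[OF h]] by simp
    \<comment> \<open>Summability over pairs justifies summing over \<open>k\<close> first and then
      over \<open>\<nu>\<close>.\<close>
    from infsum_Sigma_banach[OF this] show ?thesis
      using h by (simp add: U_def infsum_cube cube_def)
  qed
  ultimately show ?thesis using U_dual by (simp add: a_def T_def)
qed

end
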